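(* Let $G$ be a positively $0$-transitive Lie superalgebra whose positive part $G_+$ is generated by $G_1$, and let $U$ be the universal Lie superalgebra associated to $U_1:=G_1$. (a) There exist a subspace $T_{0-}\subseteq U_{0-}$ such that $T_{0-}\oplus U_+$ is a subalgebra of $U$ (in particular $T_{0-}$ is a subalgebra of $U_{0-}$), and an ideal $D_{2+}$ of $T_{0-}\oplus U_+$ contained in $U_{2+}$, such that $G\cong(T_{0-}\oplus U_+)/D_{2+}$ as Lie superalgebras. (b) Conversely, for any subspace $T_{0-}\subseteq U_{0-}$ such that $T_{0-}\oplus U_+$ is a subalgebra of $U$ and any ideal $D_{2+}$ of $T_{0-}\oplus U_+$ contained in $U_{2+}$, the quotient $(T_{0-}\oplus U_+)/D_{2+}$ is a positively $0$-transitive Lie superalgebra whose positive part is generated by its degree-$1$ subspace.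
   Context: All vector spaces are over $\mathbb{K}=\mathbb{R}$ or $\mathbb{C}$, $\mathbb{Z}$-graded, parity equal to degree mod 2; morphisms preserve degree; subalgebras and ideals are graded. A Lie superalgebra is a graded space with degree-preserving bracket satisfying $[x,y]=-(-1)^{|x||y|}[y,x]$ and $[x,[y,z]]-(-1)^{|x||y|}[y,[x,z]]=[[x,y],z]$. $G_\pm=\bigoplus_{k\ge1}G_{\pm k}$, $G_{p-}=\bigoplus_{k\le p}G_k$, $G_{p+}=\bigoplus_{k\ge p}G_k$. $G$ is positively $0$-transitive if for $x\in G_{0-}$, $[G_+,x]=0$ implies $x=0$. Universal Lie superalgebra: for $U_1$ concentrated in degree 1 (odd), put $U_0=\mathrm{End}(U_1)$, $U_{-p+1}=\mathrm{Hom}(U_1,U_{-p+2})$ for $p\ge2$; on $U_{1-}=\bigoplus_{k\le1}U_k$ define brackets recursively by $[x,u]=x(u)$, $[u,x]=-(-1)^{|x|}x(u)$, $[x,y](u)=[x,y(u)]+(-1)^{|y|}[x(u),y]$ ($x,y\in U_{0-}$, $u\in U_1$), giving a semilocal Lie superalgebra (brackets defined when degrees sum to $\le1$); $U$ is the unique Lie superalgebra extending it such that $U_+$ is the free Lie superalgebra generated by $U_1$. *)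

theory Defs
  imports Complex_Main "HOL-Library.FuncSet"
begin

record ('k, 'a) lsa =
  lcarrier :: "'a set"
  lzero :: 'a
  ladd :: "'a \<Rightarrow> 'a \<Rightarrow> 'a"
  lneg :: "'a \<Rightarrow> 'a"
  lsmul :: "'k \<Rightarrow> 'a \<Rightarrow> 'a"
  ldeg :: "int \<Rightarrow> 'a set"
  lbr :: "'a \<Rightarrow> 'a \<Rightarrow> 'a"

definition K_is_R_or_C :: "'k::field itself \<Rightarrow> bool" where
  "K_is_R_or_C _ \<longleftrightarrow>
     (\<exists>f::'k \<Rightarrow> real. bij f \<and> (\<forall>a b. f (a + b) = f a + f b \<and> f (a * b) = f a * f b))
   \<or> (\<exists>f::'k \<Rightarrow> complex. bij f \<and> (\<forall>a b. f (a + b) = f a + f b \<and> f (a * b) = f a * f b))"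

definition vs :: "('k::field, 'a) lsa \<Rightarrow> bool" where
  "vs A \<longleftrightarrow>
     lzero A \<in> lcarrier A \<and>
     (\<forall>x\<in>lcarrier A. \<forall>y\<in>lcarrier A. ladd A x y \<in> lcarrier A) \<and>
     (\<forall>x\<in>lcarrier A. lneg A x \<in> lcarrier A) \<and>
     (\<forall>a. \<forall>x\<in>lcarrier A. lsmul A a x \<in> lcarrier A) \<and>
     (\<forall>x\<in>lcarrier A. \<forall>y\<in>lcarrier A. \<forall>z\<in>lcarrier A.
        ladd A (ladd A x y) z = ladd A x (ladd A y z)) \<and>
     (\<forall>x\<in>lcarrier A. \<forall>y\<in>lcarrier A. ladd A x y = ladd A y x) \<and>
     (\<forall>x\<in>lcarrier A. ladd A (lzero A) x = x) \<and>
     (\<forall>x\<in>lcarrier A. ladd A (lneg A x) x = lzero A) \<and>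
     (\<forall>a. \<forall>x\<in>lcarrier A. \<forall>y\<in>lcarrier A.
        lsmul A a (ladd A x y) = ladd A (lsmul A a x) (lsmul A a y)) \<and>
     (\<forall>a b. \<forall>x\<in>lcarrier A. lsmul A (a + b) x = ladd A (lsmul A a x) (lsmul A b x)) \<and>
     (\<forall>a b. \<forall>x\<in>lcarrier A. lsmul A (a * b) x = lsmul A a (lsmul A b x)) \<and>
     (\<forall>x\<in>lcarrier A. lsmul A 1 x = x)"

definition subspace :: "('k, 'a) lsa \<Rightarrow> 'a set \<Rightarrow> bool" where
  "subspace A V \<longleftrightarrow> V \<subseteq> lcarrier A \<and> lzero A \<in> V \<and>
     (\<forall>x\<in>V. \<forall>y\<in>V. ladd A x y \<in> V) \<and> (\<forall>a. \<forall>x\<in>V. lsmul A a x \<in> V)"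

definition lsum :: "('k, 'a) lsa \<Rightarrow> (int \<Rightarrow> 'a) \<Rightarrow> int list \<Rightarrow> 'a" where
  "lsum A c ks = foldr (\<lambda>k acc. ladd A (c k) acc) ks (lzero A)"

definition decomp :: "('k, 'a) lsa \<Rightarrow> 'a \<Rightarrow> (int \<Rightarrow> 'a) \<Rightarrow> bool" where
  "decomp A x c \<longleftrightarrow> (\<forall>k. c k \<in> ldeg A k) \<and>
     (\<exists>n::nat. (\<forall>k. (k < - int n \<or> int n < k) \<longrightarrow> c k = lzero A) \<and>
               x = lsum A c [- int n..int n])"

definition graded :: "('k, 'a) lsa \<Rightarrow> bool" where
  "graded A \<longleftrightarrow> (\<forall>k. subspace A (ldeg A k)) \<and> (\<forall>x\<in>lcarrier A. \<exists>!c. decomp A x c)"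

definition comp :: "('k, 'a) lsa \<Rightarrow> int \<Rightarrow> 'a \<Rightarrow> 'a" where
  "comp A k x = (THE c. decomp A x c) k"

definition sneg :: "('k, 'a) lsa \<Rightarrow> bool \<Rightarrow> 'a \<Rightarrow> 'a" where
  "sneg A e v = (if e then lneg A v else v)"

definition lie_superalgebra :: "('k::field, 'a) lsa \<Rightarrow> bool" where
  "lie_superalgebra A \<longleftrightarrow> vs A \<and> graded A \<and>
     (\<forall>x\<in>lcarrier A. \<forall>y\<in>lcarrier A. lbr A x y \<in> lcarrier A) \<and>
     (\<forall>x\<in>lcarrier A. \<forall>y\<in>lcarrier A. \<forall>z\<in>lcarrier A.
        lbr A (ladd A x y) z = ladd A (lbr A x z) (lbr A y z) \<and>
        lbr A z (ladd A x y) = ladd A (lbr A z x) (lbr A z y)) \<and>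
     (\<forall>a. \<forall>x\<in>lcarrier A. \<forall>y\<in>lcarrier A.
        lbr A (lsmul A a x) y = lsmul A a (lbr A x y) \<and>
        lbr A x (lsmul A a y) = lsmul A a (lbr A x y)) \<and>
     (\<forall>i j. \<forall>x\<in>ldeg A i. \<forall>y\<in>ldeg A j. lbr A x y \<in> ldeg A (i + j)) \<and>
     (\<forall>i j. \<forall>x\<in>ldeg A i. \<forall>y\<in>ldeg A j.
        lbr A x y = lneg A (sneg A (odd i \<and> odd j) (lbr A y x))) \<and>
     (\<forall>i j. \<forall>x\<in>ldeg A i. \<forall>y\<in>ldeg A j. \<forall>z\<in>lcarrier A.
        ladd A (lbr A x (lbr A y z)) (lneg A (sneg A (odd i \<and> odd j) (lbr A y (lbr A x z))))
          = lbr A (lbr A x y) z)"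

definition lsa_hom :: "('k, 'a) lsa \<Rightarrow> ('k, 'b) lsa \<Rightarrow> ('a \<Rightarrow> 'b) \<Rightarrow> bool" where
  "lsa_hom A B f \<longleftrightarrow> (\<forall>x\<in>lcarrier A. f x \<in> lcarrier B) \<and>
     (\<forall>x\<in>lcarrier A. \<forall>y\<in>lcarrier A. f (ladd A x y) = ladd B (f x) (f y)) \<and>
     (\<forall>a. \<forall>x\<in>lcarrier A. f (lsmul A a x) = lsmul B a (f x)) \<and>
     (\<forall>x\<in>lcarrier A. \<forall>y\<in>lcarrier A. f (lbr A x y) = lbr B (f x) (f y)) \<and>
     (\<forall>k. f ` ldeg A k \<subseteq> ldeg B k)"

definition lsa_iso :: "('k, 'a) lsa \<Rightarrow> ('k, 'b) lsa \<Rightarrow> ('a \<Rightarrow> 'b) \<Rightarrow> bool" where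
  "lsa_iso A B f \<longleftrightarrow> lsa_hom A B f \<and> bij_betw f (lcarrier A) (lcarrier B)"

definition substr :: "('k, 'a) lsa \<Rightarrow> 'a set \<Rightarrow> ('k, 'a) lsa" where
  "substr A S = A\<lparr>lcarrier := S, ldeg := (\<lambda>k. ldeg A k \<inter> S)\<rparr>"

definition graded_subspace :: "('k, 'a) lsa \<Rightarrow> 'a set \<Rightarrow> bool" where
  "graded_subspace A S \<longleftrightarrow> subspace A S \<and> (\<forall>x\<in>S. \<forall>k. comp A k x \<in> S)"

definition subalgebra :: "('k, 'a) lsa \<Rightarrow> 'a set \<Rightarrow> bool" where
  "subalgebra A S \<longleftrightarrow> graded_subspace A S \<and> (\<forall>x\<in>S. \<forall>y\<in>S. lbr A x y \<in> S)"

definition ideal :: "('k, 'a) lsa \<Rightarrow> 'a set \<Rightarrow> 'a set \<Rightarrow> bool" where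
  "ideal A S D \<longleftrightarrow> graded_subspace A D \<and> D \<subseteq> S \<and> (\<forall>x\<in>S. \<forall>d\<in>D. lbr A x d \<in> D)"

definition part :: "('k, 'a) lsa \<Rightarrow> (int \<Rightarrow> bool) \<Rightarrow> 'a set" where
  "part A P = {x \<in> lcarrier A. \<forall>k. \<not> P k \<longrightarrow> comp A k x = lzero A}"

definition dsum :: "('k, 'a) lsa \<Rightarrow> 'a set \<Rightarrow> 'a set \<Rightarrow> 'a set" where
  "dsum A V W = {ladd A v w | v w. v \<in> V \<and> w \<in> W}"

definition pos_0_transitive :: "('k, 'a) lsa \<Rightarrow> bool" where
  "pos_0_transitive A \<longleftrightarrow> (\<forall>x\<in>part A (\<lambda>k. k \<le> 0).
     (\<forall>y\<in>part A (\<lambda>k. 1 \<le> k). lbr A y x = lzero A) \<longrightarrow> x = lzero A)"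

inductive_set lie_span :: "('k, 'a) lsa \<Rightarrow> 'a set \<Rightarrow> 'a set" for A X where
  gen: "x \<in> X \<Longrightarrow> x \<in> lie_span A X"
| zero: "lzero A \<in> lie_span A X"
| add: "x \<in> lie_span A X \<Longrightarrow> y \<in> lie_span A X \<Longrightarrow> ladd A x y \<in> lie_span A X"
| smul: "x \<in> lie_span A X \<Longrightarrow> lsmul A a x \<in> lie_span A X"
| br: "x \<in> lie_span A X \<Longrightarrow> y \<in> lie_span A X \<Longrightarrow> lbr A x y \<in> lie_span A X"

definition pos_generated :: "('k, 'a) lsa \<Rightarrow> bool" where
  "pos_generated A \<longleftrightarrow> lie_span A (ldeg A 1) = part A (\<lambda>k. 1 \<le> k)"

text \<open>U_+ is the free Lie superalgebra generated by U_1 (graded universal property).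
  Test algebras L range over structures on the same type 'a; since the free Lie
  superalgebra on U_1 has cardinality at most that of U_1 (or is 0), this is
  equivalent to the universal property against all Lie superalgebras.\<close>
definition free_pos :: "('k::field, 'a) lsa \<Rightarrow> bool" where
  "free_pos U \<longleftrightarrow> (\<forall>L :: ('k, 'a) lsa. \<forall>f. lie_superalgebra L \<longrightarrow>
     (\<forall>u\<in>ldeg U 1. f u \<in> ldeg L 1) \<longrightarrow>
     (\<forall>u\<in>ldeg U 1. \<forall>v\<in>ldeg U 1. f (ladd U u v) = ladd L (f u) (f v)) \<longrightarrow>
     (\<forall>a. \<forall>u\<in>ldeg U 1. f (lsmul U a u) = lsmul L a (f u)) \<longrightarrow>
     (\<exists>!h. h \<in> extensional (part U (\<lambda>k. 1 \<le> k)) \<and>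
           lsa_hom (substr U (part U (\<lambda>k. 1 \<le> k))) L h \<and> (\<forall>u\<in>ldeg U 1. h u = f u)))"

definition linmaps :: "('k, 'a) lsa \<Rightarrow> 'a set \<Rightarrow> 'a set \<Rightarrow> ('a \<Rightarrow> 'a) set" where
  "linmaps A V W = {f \<in> extensional V. (\<forall>v\<in>V. f v \<in> W) \<and>
     (\<forall>u\<in>V. \<forall>v\<in>V. f (ladd A u v) = ladd A (f u) (f v)) \<and>
     (\<forall>a. \<forall>v\<in>V. f (lsmul A a v) = lsmul A a (f v))}"

text \<open>U is the universal Lie superalgebra associated with U_1 := G_1 (identified via the
  linear isomorphism j): U_+ free on U_1, and for k \<le> 0 the map x \<mapsto> (u \<mapsto> [x,u])
  identifies U_k with Hom(U_1, U_{k+1}) (so U_0 = End(U_1), U_{-p+1} = Hom(U_1,U_{-p+2}),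
  [x,u] = x(u)); the remaining brackets are then forced by the Lie superalgebra axioms.\<close>
definition universal_lsa :: "('k::field, 'g) lsa \<Rightarrow> ('k, 'a) lsa \<Rightarrow> ('g \<Rightarrow> 'a) \<Rightarrow> bool" where
  "universal_lsa G U j \<longleftrightarrow> lie_superalgebra U \<and>
     bij_betw j (ldeg G 1) (ldeg U 1) \<and>
     (\<forall>u\<in>ldeg G 1. \<forall>v\<in>ldeg G 1. j (ladd G u v) = ladd U (j u) (j v)) \<and>
     (\<forall>a. \<forall>u\<in>ldeg G 1. j (lsmul G a u) = lsmul U a (j u)) \<and>
     free_pos U \<and>
     (\<forall>k\<le>0. bij_betw (\<lambda>x. restrict (\<lambda>u. lbr U x u) (ldeg U 1))
                      (ldeg U k) (linmaps U (ldeg U 1) (ldeg U (k + 1))))"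

definition coset :: "('k, 'a) lsa \<Rightarrow> 'a set \<Rightarrow> 'a \<Rightarrow> 'a set" where
  "coset A D x = {ladd A x d | d. d \<in> D}"

definition quot :: "('k, 'a) lsa \<Rightarrow> 'a set \<Rightarrow> 'a set \<Rightarrow> ('k, 'a set) lsa" where
  "quot A S D = \<lparr> lcarrier = coset A D ` S,
     lzero = coset A D (lzero A),
     ladd = (\<lambda>X Y. coset A D (ladd A (SOME x. x \<in> X) (SOME y. y \<in> Y))),
     lneg = (\<lambda>X. coset A D (lneg A (SOME x. x \<in> X))),
     lsmul = (\<lambda>a X. coset A D (lsmul A a (SOME x. x \<in> X))),
     ldeg = (\<lambda>k. coset A D ` (S \<inter> ldeg A k)),
     lbr = (\<lambda>X Y. coset A D (lbr A (SOME x. x \<in> X) (SOME y. y \<in> Y))) \<rparr>"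

end

theory Submission
  imports Defs
begin

text \<open>Write \<open>\<psi>\<close> for the homomorphism from \<open>U\<^sub>+\<close> onto \<open>G\<^sub>+\<close> given by freeness, and \<open>\<phi>\<close> for the map from the
  non-positive part of \<open>G\<close> to that of \<open>U\<close> obtained degree by degree from
  \<open>[\<phi> x, u] = \<phi> [x, u]\<close> for \<open>u\<close> in degree 1. Transitivity makes \<open>\<phi>\<close> injective, and the Jacobi identity makes
  it a homomorphism. The graph of \<open>\<phi>\<close> in degrees \<open>\<le> 0\<close> together with the graph of \<open>\<psi>\<close> in degrees
  \<open>\<ge> 1\<close> is a graded subalgebra of \<open>U \<times> G\<close>: the mixed brackets follow by induction along the generation of
  \<open>U\<^sub>+\<close> by \<open>U\<^sub>1\<close>. This relation is single-valued and onto \<open>G\<close>; its domain is \<open>T \<oplus> U\<^sub>+\<close> and its kernel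
  \<open>D\<close> vanishes in degrees \<open>\<le> 1\<close>, so \<open>G\<close> is the quotient. Conversely, an ideal without components in degrees \<open>\<le> 1\<close>
  does not affect the brackets with \<open>U\<^sub>1\<close> of elements of non-positive degree, and these brackets
  determine such elements of \<open>U\<close>.\<close>

section \<open>Graded vector spaces and Lie superalgebras\<close>

text \<open>The Koszul sign as a scalar: together with \<open>neg_eq\<close> it absorbs
  \<open>lneg\<close> and \<open>sneg\<close> into \<open>lsmul\<close>, so that sign bookkeeping
  becomes arithmetic in the field.\<close>

definition ssign :: "int \<Rightarrow> int \<Rightarrow> 'k::field" where
  "ssign i j = (if odd i \<and> odd j then - 1 else 1)"

lemma lsum_Nil [simp]: "lsum A c [] = lzero A"
  and lsum_Cons [simp]: "lsum A c (k # ks) = ladd A (c k) (lsum A c ks)"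
  by (simp_all add: lsum_def)

locale graded_vs =
  fixes A :: "('k::field, 'a) lsa"
  assumes vs: "vs A" and graded: "graded A"
begin

lemma zero_closed [simp]: "lzero A \<in> lcarrier A"
  and add_closed [simp]: "x \<in> lcarrier A \<Longrightarrow> y \<in> lcarrier A \<Longrightarrow> ladd A x y \<in> lcarrier A"
  and neg_closed [simp]: "x \<in> lcarrier A \<Longrightarrow> lneg A x \<in> lcarrier A"
  and smul_closed [simp]: "x \<in> lcarrier A \<Longrightarrow> lsmul A a x \<in> lcarrier A"
  using vs by (simp_all add: vs_def)

lemma add_assoc: "x \<in> lcarrier A \<Longrightarrow> y \<in> lcarrier A \<Longrightarrow> z \<in> lcarrier A
    \<Longrightarrow> ladd A (ladd A x y) z = ladd A x (ladd A y z)"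
  and add_commute: "x \<in> lcarrier A \<Longrightarrow> y \<in> lcarrier A \<Longrightarrow> ladd A x y = ladd A y x"
  and zero_add [simp]: "x \<in> lcarrier A \<Longrightarrow> ladd A (lzero A) x = x"
  and neg_add: "x \<in> lcarrier A \<Longrightarrow> ladd A (lneg A x) x = lzero A"
  and smul_add: "x \<in> lcarrier A \<Longrightarrow> y \<in> lcarrier A
    \<Longrightarrow> lsmul A a (ladd A x y) = ladd A (lsmul A a x) (lsmul A a y)"
  and add_smul: "x \<in> lcarrier A \<Longrightarrow> lsmul A (a + b) x = ladd A (lsmul A a x) (lsmul A b x)"
  and mul_smul: "x \<in> lcarrier A \<Longrightarrow> lsmul A (a * b) x = lsmul A a (lsmul A b x)"
  and one_smul [simp]: "x \<in> lcarrier A \<Longrightarrow> lsmul A 1 x = x"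
  using vs unfolding vs_def by blast+

lemma add_zero [simp]: "x \<in> lcarrier A \<Longrightarrow> ladd A x (lzero A) = x"
  using add_commute[of x "lzero A"] by simp

lemma add_left_commute: "x \<in> lcarrier A \<Longrightarrow> y \<in> lcarrier A \<Longrightarrow> z \<in> lcarrier A
    \<Longrightarrow> ladd A x (ladd A y z) = ladd A y (ladd A x z)"
  by (metis add_assoc add_commute)

lemmas add_ac = add_assoc add_commute add_left_commute

lemma add_left_cancel:
  assumes "x \<in> lcarrier A" "y \<in> lcarrier A" "z \<in> lcarrier A"
  shows "ladd A x y = ladd A x z \<longleftrightarrow> y = z"
  by (metis assms add_assoc neg_add neg_closed zero_add)

lemma zero_smul [simp]:
  assumes "x \<in> lcarrier A" shows "lsmul A 0 x = lzero A"
  using add_smul[OF assms, of 0 0] add_left_cancel[of "lsmul A 0 x" "lsmul A 0 x" "lzero A"] assms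
  by simp

lemma smul_zero [simp]: "lsmul A a (lzero A) = lzero A"
  using smul_add[of "lzero A" "lzero A" a]
    add_left_cancel[of "lsmul A a (lzero A)" "lsmul A a (lzero A)" "lzero A"]
  by simp

lemma add_minus:
  assumes "x \<in> lcarrier A" shows "ladd A x (lsmul A (- 1) x) = lzero A"
  using add_smul[OF assms, of 1 "- 1"] assms by simp

lemma neg_eq: "x \<in> lcarrier A \<Longrightarrow> lneg A x = lsmul A (- 1) x"
  using add_left_cancel[of x "lneg A x" "lsmul A (- 1) x"] add_minus[of x] neg_add[of x]
    add_commute[of x "lneg A x"]
  by simp

lemma add_neg: "x \<in> lcarrier A \<Longrightarrow> ladd A x (lneg A x) = lzero A"
  by (simp add: neg_eq add_minus)

lemma add_diff_cancel:
  assumes "x \<in> lcarrier A" "y \<in> lcarrier A"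
  shows "ladd A y (ladd A x (lsmul A (- 1) y)) = x"
  using assms by (simp add: add_left_commute[of y x] add_minus)

lemma diff_eq_zero:
  assumes "x \<in> lcarrier A" "y \<in> lcarrier A" "ladd A x (lsmul A (- 1) y) = lzero A"
  shows "x = y"
  using add_diff_cancel[OF assms(1,2)] assms by simp

lemma deg_carrier: "x \<in> ldeg A k \<Longrightarrow> x \<in> lcarrier A"
  and deg_zero [simp]: "lzero A \<in> ldeg A k"
  and deg_add: "x \<in> ldeg A k \<Longrightarrow> y \<in> ldeg A k \<Longrightarrow> ladd A x y \<in> ldeg A k"
  and deg_smul: "x \<in> ldeg A k \<Longrightarrow> lsmul A a x \<in> ldeg A k"
  using graded by (auto simp: graded_def subspace_def)

lemma lsum_closed [simp]: "(\<And>k. c k \<in> lcarrier A) \<Longrightarrow> lsum A c ks \<in> lcarrier A"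
  by (induction ks) auto

lemma lsum_add:
  assumes "\<And>k. c k \<in> lcarrier A" "\<And>k. d k \<in> lcarrier A"
  shows "lsum A (\<lambda>k. ladd A (c k) (d k)) ks = ladd A (lsum A c ks) (lsum A d ks)"
  by (induction ks) (simp_all add: assms add_ac)

lemma lsum_smul:
  assumes "\<And>k. c k \<in> lcarrier A"
  shows "lsum A (\<lambda>k. lsmul A a (c k)) ks = lsmul A a (lsum A c ks)"
  by (induction ks) (simp_all add: assms smul_add)

lemma lsum_filter:
  assumes "\<And>k. c k \<in> lcarrier A"
  shows "lsum A c (filter (\<lambda>k. c k \<noteq> lzero A) ks) = lsum A c ks"
  by (induction ks) (auto simp: assms)

text \<open>Discarding zero summands leaves the same list of degrees for both ranges: the two
  filtered lists are sorted, distinct and have equal sets.\<close>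

lemma lsum_widen:
  assumes "\<And>k. c k \<in> lcarrier A" "\<And>k. k < - int n \<or> int n < k \<Longrightarrow> c k = lzero A" "n \<le> m"
  shows "lsum A c [- int m..int m] = lsum A c [- int n..int n]"
proof -
  have "filter (\<lambda>k. c k \<noteq> lzero A) [- int m..int m] = filter (\<lambda>k. c k \<noteq> lzero A) [- int n..int n]"
  proof (rule sorted_distinct_set_unique)
    show "set (filter (\<lambda>k. c k \<noteq> lzero A) [- int m..int m])
        = set (filter (\<lambda>k. c k \<noteq> lzero A) [- int n..int n])"
      using assms(2,3) by auto force+
  qed (simp_all add: sorted_wrt_filter)
  then show ?thesis
    using lsum_filter[of c "[- int m..int m]"] lsum_filter[of c "[- int n..int n]"] assms(1)
    by simp
qed

lemma lsum_single:
  assumes "x \<in> lcarrier A" "distinct ks"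
  shows "lsum A (\<lambda>k. if k = i then x else lzero A) ks = (if i \<in> set ks then x else lzero A)"
  using assms(2) by (induction ks) (use assms(1) in auto)

section \<open>Homogeneous decompositions and components\<close>

lemma decompI:
  assumes "\<And>k. c k \<in> ldeg A k" "\<And>k. k < - int n \<or> int n < k \<Longrightarrow> c k = lzero A"
  shows "decomp A (lsum A c [- int n..int n]) c"
  using assms by (auto simp: decomp_def)

text \<open>\<open>decomp\<close> supplies some cutoff only. Having all larger cutoffs available
  lets two decompositions be compared or added over a common range.\<close>

lemma decomp_eventually:
  assumes "decomp A x c"
  shows "\<exists>n. \<forall>m\<ge>n. (\<forall>k. k < - int m \<or> int m < k \<longrightarrow> c k = lzero A)
    \<and> lsum A c [- int m..int m] = x"
proof -
  from assms obtain n where n: "\<And>k. c k \<in> ldeg A k"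
      "\<And>k. k < - int n \<or> int n < k \<Longrightarrow> c k = lzero A" "x = lsum A c [- int n..int n]"
    unfolding decomp_def by blast
  have "lsum A c [- int m..int m] = x" if "n \<le> m" for m
    unfolding n(3) by (rule lsum_widen) (use n(1,2) that deg_carrier in auto)
  then show ?thesis using n(2) by (intro exI[of _ n]) auto
qed

lemma decomp_in_deg: "decomp A x c \<Longrightarrow> c k \<in> ldeg A k"
  by (simp add: decomp_def)

lemma decomp_carrier: "decomp A x c \<Longrightarrow> x \<in> lcarrier A"
  unfolding decomp_def using lsum_closed deg_carrier by blast

lemma decomp_comp:
  assumes "x \<in> lcarrier A" shows "decomp A x (\<lambda>k. comp A k x)"
proof -
  have "\<exists>!c. decomp A x c" using graded assms by (auto simp: graded_def)
  then show ?thesis unfolding comp_def by (rule theI')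
qed

lemma lsum_comp:
  assumes "x \<in> lcarrier A"
  shows "\<exists>n. \<forall>m\<ge>n. lsum A (\<lambda>k. comp A k x) [- int m..int m] = x"
  using decomp_eventually[OF decomp_comp[OF assms]] by blast

lemma comp_eqI: "decomp A x c \<Longrightarrow> comp A k x = c k"
  using graded decomp_carrier[of x c] decomp_comp[of x] unfolding graded_def
  by metis

lemma comp_deg [simp]: "x \<in> lcarrier A \<Longrightarrow> comp A k x \<in> ldeg A k"
  using decomp_comp by (auto simp: decomp_def)

lemma comp_carrier [simp]: "x \<in> lcarrier A \<Longrightarrow> comp A k x \<in> lcarrier A"
  using comp_deg deg_carrier by blast

lemma decomp_unique: "decomp A x c \<Longrightarrow> decomp A y c \<Longrightarrow> x = y"
  using decomp_eventually[of x c] decomp_eventually[of y c] by (metis nat_le_linear)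

lemma eq_by_comp:
  assumes "x \<in> lcarrier A" "y \<in> lcarrier A" "\<And>k. comp A k x = comp A k y"
  shows "x = y"
  using decomp_comp[OF assms(1)] decomp_comp[OF assms(2)] decomp_unique assms(3) by simp

lemma ex_with_comps:
  assumes "\<And>k. c k \<in> ldeg A k" "\<And>k. k < - int n \<or> int n < k \<Longrightarrow> c k = lzero A"
  shows "\<exists>x\<in>lcarrier A. \<forall>k. comp A k x = c k"
  using decompI[of c n] assms comp_eqI decomp_carrier by blast

lemma comp_bound:
  assumes "x \<in> lcarrier A"
  shows "\<exists>n. \<forall>k. k < - int n \<or> int n < k \<longrightarrow> comp A k x = lzero A"
  using decomp_comp[OF assms] unfolding decomp_def by blast

lemma decomp_add:
  assumes "decomp A x c" "decomp A y d"
  shows "decomp A (ladd A x y) (\<lambda>k. ladd A (c k) (d k))"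
proof -
  have c: "c k \<in> ldeg A k" and d: "d k \<in> ldeg A k" for k
    using assms decomp_in_deg by auto
  have c': "c k \<in> lcarrier A" and d': "d k \<in> lcarrier A" for k
    using c d deg_carrier by auto
  obtain n where n: "\<And>m k. n \<le> m \<Longrightarrow> k < - int m \<or> int m < k \<Longrightarrow> c k = lzero A"
     "\<And>m. n \<le> m \<Longrightarrow> lsum A c [- int m..int m] = x"
    using decomp_eventually[OF assms(1)] by blast
  obtain n' where n': "\<And>m k. n' \<le> m \<Longrightarrow> k < - int m \<or> int m < k \<Longrightarrow> d k = lzero A"
     "\<And>m. n' \<le> m \<Longrightarrow> lsum A d [- int m..int m] = y"
    using decomp_eventually[OF assms(2)] by blast
  define m where "m = max n n'"
  have m: "n \<le> m" "n' \<le> m" by (simp_all add: m_def)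
  have "decomp A (lsum A (\<lambda>k. ladd A (c k) (d k)) [- int m..int m]) (\<lambda>k. ladd A (c k) (d k))"
    by (rule decompI) (use n(1)[OF m(1)] n'(1)[OF m(2)] c d in \<open>auto intro: deg_add\<close>)
  then show ?thesis
    using n(2)[OF m(1)] n'(2)[OF m(2)] lsum_add[of c d] c' d' by simp
qed

lemma decomp_smul:
  assumes "decomp A x c"
  shows "decomp A (lsmul A a x) (\<lambda>k. lsmul A a (c k))"
proof -
  have c: "c k \<in> ldeg A k" for k
    using assms decomp_in_deg by auto
  have c': "c k \<in> lcarrier A" for k
    using c deg_carrier by auto
  obtain n where n: "\<And>k. k < - int n \<or> int n < k \<Longrightarrow> c k = lzero A"
     "lsum A c [- int n..int n] = x"
    using decomp_eventually[OF assms] by blast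
  have "decomp A (lsum A (\<lambda>k. lsmul A a (c k)) [- int n..int n]) (\<lambda>k. lsmul A a (c k))"
    by (rule decompI) (use n(1) c in \<open>auto intro: deg_smul\<close>)
  then show ?thesis
    using n(2) lsum_smul[of c a] c' by simp
qed

lemma decomp_deg:
  assumes "x \<in> ldeg A i"
  shows "decomp A x (\<lambda>k. if k = i then x else lzero A)"
proof -
  have "decomp A (lsum A (\<lambda>k. if k = i then x else lzero A) [- int (nat \<bar>i\<bar>)..int (nat \<bar>i\<bar>)])
      (\<lambda>k. if k = i then x else lzero A)"
    by (rule decompI) (use assms in auto)
  then show ?thesis
    using lsum_single[OF deg_carrier[OF assms], of "[- int (nat \<bar>i\<bar>)..int (nat \<bar>i\<bar>)]" i]
    by (simp add: abs_if split: if_splits)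
qed

lemma comp_add [simp]: "x \<in> lcarrier A \<Longrightarrow> y \<in> lcarrier A
    \<Longrightarrow> comp A k (ladd A x y) = ladd A (comp A k x) (comp A k y)"
  using comp_eqI[OF decomp_add[OF decomp_comp decomp_comp]] .

lemma comp_smul [simp]: "x \<in> lcarrier A \<Longrightarrow> comp A k (lsmul A a x) = lsmul A a (comp A k x)"
  using comp_eqI[OF decomp_smul[OF decomp_comp]] .

lemma comp_homogeneous: "x \<in> ldeg A i \<Longrightarrow> comp A k x = (if k = i then x else lzero A)"
  using comp_eqI[OF decomp_deg] .

lemma comp_zero [simp]: "comp A k (lzero A) = lzero A"
  using comp_homogeneous[of "lzero A" k k] by simp

lemma restrict_comps:
  assumes "x \<in> lcarrier A"
  shows "\<exists>y\<in>lcarrier A. \<forall>k. comp A k y = (if P k then comp A k x else lzero A)"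
proof -
  obtain n where "\<And>k. k < - int n \<or> int n < k \<Longrightarrow> comp A k x = lzero A"
    using comp_bound[OF assms] by blast
  then show ?thesis by (intro ex_with_comps[of _ n]) (auto simp: assms)
qed

text \<open>An element is a finite sum of its components, so a property stable under addition passes
  from homogeneous elements to all. Bilinear statements about brackets are reduced to homogeneous
  arguments by using this once in each variable.\<close>

lemma graded_induct:
  assumes "x \<in> lcarrier A" "Q (lzero A)"
    and "\<And>u v. u \<in> lcarrier A \<Longrightarrow> v \<in> lcarrier A \<Longrightarrow> Q u \<Longrightarrow> Q v \<Longrightarrow> Q (ladd A u v)"
    and "\<And>k. Q (comp A k x)"
  shows "Q x"
proof -
  have Q: "Q (lsum A (\<lambda>k. comp A k x) ks)" for ks
    by (induction ks) (use assms in simp_all)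
  obtain n where n: "\<And>m. n \<le> m \<Longrightarrow> lsum A (\<lambda>k. comp A k x) [- int m..int m] = x"
    using lsum_comp[OF assms(1)] by blast
  show ?thesis
    using Q[of "[- int n..int n]"] n[of n] by simp
qed

lemma part_deg: "x \<in> ldeg A k \<Longrightarrow> P k \<Longrightarrow> x \<in> part A P"
  using deg_carrier[of x k] comp_homogeneous[of x k] by (auto simp: part_def)

lemma part_carrier: "x \<in> part A P \<Longrightarrow> x \<in> lcarrier A"
  by (simp add: part_def)

lemma part_zero [simp]: "lzero A \<in> part A P"
  by (simp add: part_def)

lemma part_add: "x \<in> part A P \<Longrightarrow> y \<in> part A P \<Longrightarrow> ladd A x y \<in> part A P"
  by (simp add: part_def)

lemma part_smul: "x \<in> part A P \<Longrightarrow> lsmul A a x \<in> part A P"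
  by (simp add: part_def)

lemma comp_comp [simp]:
  "x \<in> lcarrier A \<Longrightarrow> comp A i (comp A k x) = (if i = k then comp A k x else lzero A)"
  using comp_homogeneous[OF comp_deg] .

lemma part_comp: "x \<in> part A P \<Longrightarrow> comp A k x \<in> part A P"
  by (auto simp: part_def)

end

text \<open>The two elements have to be summed in parallel over the same degrees; a common cutoff
  exists because any sufficiently large one works for each of them.\<close>

lemma graded_pair_induct:
  assumes "graded_vs A" "graded_vs B" "x \<in> lcarrier A" "y \<in> lcarrier B"
    and "Q (lzero A) (lzero B)"
    and "\<And>u v u' v'. u \<in> lcarrier A \<Longrightarrow> u' \<in> lcarrier A \<Longrightarrow> v \<in> lcarrier B \<Longrightarrow> v' \<in> lcarrier B
      \<Longrightarrow> Q u v \<Longrightarrow> Q u' v' \<Longrightarrow> Q (ladd A u u') (ladd B v v')"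
    and "\<And>k. Q (comp A k x) (comp B k y)"
  shows "Q x y"
proof -
  interpret A: graded_vs A by fact
  interpret B: graded_vs B by fact
  have Q: "Q (lsum A (\<lambda>k. comp A k x) ks) (lsum B (\<lambda>k. comp B k y) ks)" for ks
  proof (induction ks)
    case (Cons k ks)
    then show ?case
      unfolding lsum_Cons by (intro assms(6,7)) (simp_all add: assms(3,4))
  qed (simp add: assms(5))
  obtain n where n: "\<And>m. n \<le> m \<Longrightarrow> lsum A (\<lambda>k. comp A k x) [- int m..int m] = x"
    using A.lsum_comp[OF assms(3)] by blast
  obtain n' where n': "\<And>m. n' \<le> m \<Longrightarrow> lsum B (\<lambda>k. comp B k y) [- int m..int m] = y"
    using B.lsum_comp[OF assms(4)] by blast
  show ?thesis
    using Q[of "[- int (max n n')..int (max n n')]"] n[of "max n n'"] n'[of "max n n'"] by simp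
qed

locale lsalg = graded_vs A for A :: "('k::field, 'a) lsa" +
  assumes lie: "lie_superalgebra A"
begin

lemmas lie_conjs = lie[unfolded lie_superalgebra_def, THEN conjunct2, THEN conjunct2]

lemma br_closed [simp]: "x \<in> lcarrier A \<Longrightarrow> y \<in> lcarrier A \<Longrightarrow> lbr A x y \<in> lcarrier A"
  using lie_conjs[THEN conjunct1] by blast

lemma br_add_left: "x \<in> lcarrier A \<Longrightarrow> y \<in> lcarrier A \<Longrightarrow> z \<in> lcarrier A
    \<Longrightarrow> lbr A (ladd A x y) z = ladd A (lbr A x z) (lbr A y z)"
  and br_add_right: "x \<in> lcarrier A \<Longrightarrow> y \<in> lcarrier A \<Longrightarrow> z \<in> lcarrier A
    \<Longrightarrow> lbr A z (ladd A x y) = ladd A (lbr A z x) (lbr A z y)"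
  using lie_conjs[THEN conjunct2, THEN conjunct1] by blast+

lemma br_smul_left: "x \<in> lcarrier A \<Longrightarrow> y \<in> lcarrier A
    \<Longrightarrow> lbr A (lsmul A a x) y = lsmul A a (lbr A x y)"
  and br_smul_right: "x \<in> lcarrier A \<Longrightarrow> y \<in> lcarrier A
    \<Longrightarrow> lbr A x (lsmul A a y) = lsmul A a (lbr A x y)"
  using lie_conjs[THEN conjunct2, THEN conjunct2, THEN conjunct1] by blast+

lemma br_deg: "x \<in> ldeg A i \<Longrightarrow> y \<in> ldeg A j \<Longrightarrow> lbr A x y \<in> ldeg A (i + j)"
  using lie_conjs[THEN conjunct2, THEN conjunct2, THEN conjunct2, THEN conjunct1] by blast

lemma br_zero_left [simp]: "x \<in> lcarrier A \<Longrightarrow> lbr A (lzero A) x = lzero A"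
  using br_smul_left[of "lzero A" x 0] by simp

lemma br_zero_right [simp]: "x \<in> lcarrier A \<Longrightarrow> lbr A x (lzero A) = lzero A"
  using br_smul_right[of x "lzero A" 0] by simp

lemma sneg_eq: "x \<in> lcarrier A \<Longrightarrow> sneg A (odd i \<and> odd j) x = lsmul A (ssign i j) x"
  by (simp add: sneg_def ssign_def neg_eq)

lemma antisym_axiom: "x \<in> ldeg A i \<Longrightarrow> y \<in> ldeg A j
    \<Longrightarrow> lbr A x y = lneg A (sneg A (odd i \<and> odd j) (lbr A y x))"
  using lie_conjs[THEN conjunct2, THEN conjunct2, THEN conjunct2, THEN conjunct2, THEN conjunct1]
  by blast

lemma jacobi_axiom: "x \<in> ldeg A i \<Longrightarrow> y \<in> ldeg A j \<Longrightarrow> z \<in> lcarrier A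
    \<Longrightarrow> ladd A (lbr A x (lbr A y z)) (lneg A (sneg A (odd i \<and> odd j) (lbr A y (lbr A x z))))
          = lbr A (lbr A x y) z"
  using lie_conjs[THEN conjunct2, THEN conjunct2, THEN conjunct2, THEN conjunct2, THEN conjunct2]
  by blast

lemma antisym:
  assumes "x \<in> ldeg A i" "y \<in> ldeg A j"
  shows "lbr A x y = lsmul A (- ssign i j) (lbr A y x)"
proof -
  have "lbr A x y = lneg A (sneg A (odd i \<and> odd j) (lbr A y x))"
    using antisym_axiom[OF assms] .
  also have "\<dots> = lsmul A (- ssign i j) (lbr A y x)"
    using assms[THEN deg_carrier] by (simp add: sneg_eq neg_eq flip: mul_smul)
  finally show ?thesis .
qed

lemma jacobi:
  assumes "x \<in> ldeg A i" "y \<in> ldeg A j" "z \<in> lcarrier A"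
  shows "lbr A (lbr A x y) z
    = ladd A (lbr A x (lbr A y z)) (lsmul A (- ssign i j) (lbr A y (lbr A x z)))"
proof -
  have "lbr A (lbr A x y) z
      = ladd A (lbr A x (lbr A y z)) (lneg A (sneg A (odd i \<and> odd j) (lbr A y (lbr A x z))))"
    using jacobi_axiom[OF assms] by simp
  then show ?thesis
    using assms(1,2)[THEN deg_carrier] assms(3) by (simp add: sneg_eq neg_eq flip: mul_smul)
qed

text \<open>The Jacobi identity solved for the nested bracket: \<open>lbr A x\<close> is a
  superderivation. This is the form in which an induction over iterated brackets consumes
  it.\<close>

lemma br_derivation:
  assumes "x \<in> ldeg A i" "y \<in> ldeg A j" "z \<in> lcarrier A"
  shows "lbr A x (lbr A y z)
    = ladd A (lbr A (lbr A x y) z) (lsmul A (ssign i j) (lbr A y (lbr A x z)))"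
proof -
  have [simp]: "x \<in> lcarrier A" "y \<in> lcarrier A" "z \<in> lcarrier A"
    using assms deg_carrier by auto
  have "ladd A (lsmul A (- ssign i j) (lbr A y (lbr A x z))) (lsmul A (ssign i j) (lbr A y (lbr A x z)))
      = lzero A"
    by (simp flip: add_smul)
  then show ?thesis
    by (simp add: jacobi[OF assms] add_assoc)
qed

end

lemma lsalgI: "lie_superalgebra A \<Longrightarrow> lsalg A"
  by (rule lsalg.intro, rule graded_vs.intro) (unfold lsalg_axioms_def lie_superalgebra_def, iprover+)

section \<open>Generation in degree 1, subalgebras and images\<close>

text \<open>A homogeneous variant of \<open>lie_span\<close> that records the degree, so that
  inductions along the generation by degree 1 can apply the sign rules, which hold for homogeneous
  elements.\<close>

inductive hspan :: "('k, 'a) lsa \<Rightarrow> int \<Rightarrow> 'a \<Rightarrow> bool" for A where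
  gen: "x \<in> ldeg A 1 \<Longrightarrow> hspan A 1 x"
| zero: "hspan A k (lzero A)"
| add: "hspan A k x \<Longrightarrow> hspan A k y \<Longrightarrow> hspan A k (ladd A x y)"
| smul: "hspan A k x \<Longrightarrow> hspan A k (lsmul A a x)"
| br: "hspan A i x \<Longrightarrow> hspan A j y \<Longrightarrow> hspan A (i + j) (lbr A x y)"

context lsalg
begin

lemma hspan_deg: "hspan A k x \<Longrightarrow> x \<in> ldeg A k"
  by (induction rule: hspan.induct) (auto intro: deg_add deg_smul br_deg)

lemma hspan_carrier: "hspan A k x \<Longrightarrow> x \<in> lcarrier A"
  using hspan_deg deg_carrier by blast

text \<open>If the degrees of two factors have a nonpositive sum, one of them is nonpositive, and
  that factor is zero by induction.\<close>

lemma hspan_nonpos: "hspan A k x \<Longrightarrow> k \<le> 0 \<Longrightarrow> x = lzero A"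
proof (induction rule: hspan.induct)
  case (br i x j y)
  then show ?case
    using hspan_carrier[of i x] hspan_carrier[of j y] by (cases "i \<le> 0") auto
qed auto

lemma hspan_lie_span: "hspan A k x \<Longrightarrow> x \<in> lie_span A (ldeg A 1)"
  by (induction rule: hspan.induct) (auto intro: lie_span.intros)

lemma lie_span_comp:
  "x \<in> lie_span A (ldeg A 1) \<Longrightarrow> x \<in> lcarrier A \<and> (\<forall>k. hspan A k (comp A k x))"
proof (induction rule: lie_span.induct)
  case (gen x)
  then show ?case
    using comp_homogeneous[OF gen] deg_carrier[OF gen] by (auto intro: hspan.intros)
next
  case (br x y)
  \<comment> \<open>\<open>H\<close> is closed under addition and contains the brackets of
    homogeneous generated elements, so expanding \<open>y\<close> and then \<open>x\<close> into
    components places \<open>lbr A x y\<close> in it.\<close>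
  define H where "H = {x \<in> lcarrier A. \<forall>k. hspan A k (comp A k x)}"
  have H0: "lzero A \<in> H" by (simp add: H_def hspan.zero)
  have Hadd: "u \<in> H \<Longrightarrow> v \<in> H \<Longrightarrow> ladd A u v \<in> H" for u v
    by (simp add: H_def hspan.add)
  have Hbr: "lbr A u v \<in> H" if "hspan A i u" "hspan A j v" for u v i j
    using hspan.br[OF that] hspan_deg[OF hspan.br[OF that]] hspan_carrier[OF hspan.br[OF that]]
      comp_homogeneous[of "lbr A u v" "i + j"]
    by (auto simp: H_def hspan.zero)
  have x: "x \<in> lcarrier A" "\<And>k. hspan A k (comp A k x)"
    and y: "y \<in> lcarrier A" "\<And>k. hspan A k (comp A k y)" using br.IH by auto
  have "lbr A (comp A i x) y \<in> H" for i
    by (rule graded_induct[where Q = "\<lambda>v. lbr A (comp A i x) v \<in> H", OF y(1)])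
      (use x y in \<open>auto simp: H0 br_add_right intro: Hadd Hbr\<close>)
  then have "lbr A x y \<in> H"
    by (intro graded_induct[where Q = "\<lambda>v. lbr A v y \<in> H", OF x(1)])
      (use x y in \<open>auto simp: H0 br_add_left intro: Hadd\<close>)
  then show ?case by (simp add: H_def)
qed (auto intro: hspan.intros)

lemma lie_span_subset_part: "lie_span A (ldeg A 1) \<subseteq> part A (\<lambda>k. 1 \<le> k)"
proof
  fix x assume "x \<in> lie_span A (ldeg A 1)"
  then have "x \<in> lcarrier A" "hspan A k (comp A k x)" for k using lie_span_comp by auto
  moreover have "comp A k x = lzero A" if "\<not> 1 \<le> k" for k
    by (rule hspan_nonpos[OF calculation(2)]) (use that in simp)
  ultimately show "x \<in> part A (\<lambda>k. 1 \<le> k)" by (simp add: part_def)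
qed

lemma pos_generated_hspan:
  assumes "pos_generated A" "1 \<le> k" "x \<in> ldeg A k"
  shows "hspan A k x"
proof -
  have "x \<in> lie_span A (ldeg A 1)"
    using assms part_deg[of x k "\<lambda>k. 1 \<le> k"] by (auto simp: pos_generated_def)
  then show ?thesis using lie_span_comp[of x] comp_homogeneous[OF assms(3), of k] by metis
qed

lemma pos_generatedI:
  assumes "\<And>x. x \<in> part A (\<lambda>k. 1 \<le> k) \<Longrightarrow> x \<in> lie_span A (ldeg A 1)"
  shows "pos_generated A"
  using assms lie_span_subset_part by (auto simp: pos_generated_def)

end

section \<open>Graded subalgebras as Lie superalgebras\<close>

lemma substr_simps [simp]:
  "lcarrier (substr A S) = S" "lzero (substr A S) = lzero A" "ladd (substr A S) = ladd A"
  "lneg (substr A S) = lneg A" "lsmul (substr A S) = lsmul A" "lbr (substr A S) = lbr A"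
  "ldeg (substr A S) k = ldeg A k \<inter> S" "lsum (substr A S) = lsum A" "sneg (substr A S) = sneg A"
  by (auto simp: substr_def lsum_def sneg_def fun_eq_iff)

lemma decomp_substr: "decomp (substr A S) x c \<longleftrightarrow> decomp A x c \<and> (\<forall>k. c k \<in> S)"
  by (auto simp: decomp_def)

context lsalg
begin

lemma comp_substr:
  assumes "graded_subspace A S" "x \<in> S"
  shows "comp (substr A S) k x = comp A k x"
    and "\<exists>!c. decomp (substr A S) x c"
proof -
  have x: "x \<in> lcarrier A" "\<And>k. comp A k x \<in> S"
    using assms by (auto simp: graded_subspace_def subspace_def)
  have d: "decomp (substr A S) x (\<lambda>k. comp A k x)"
    using decomp_comp[OF x(1)] x(2) by (simp add: decomp_substr)
  have u: "c = (\<lambda>k. comp A k x)" if "decomp (substr A S) x c" for c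
    using that comp_eqI[of x c] by (auto simp: decomp_substr)
  show "\<exists>!c. decomp (substr A S) x c" using d u by blast
  show "comp (substr A S) k x = comp A k x"
    unfolding comp_def[of "substr A S"] using the_equality[of "decomp (substr A S) x", OF d] u by simp
qed

lemma lie_superalgebra_substr:
  assumes "subalgebra A S"
  shows "lie_superalgebra (substr A S)"
proof -
  have gs: "graded_subspace A S" and br: "\<And>x y. x \<in> S \<Longrightarrow> y \<in> S \<Longrightarrow> lbr A x y \<in> S"
    using assms by (auto simp: subalgebra_def)
  have S: "\<And>x. x \<in> S \<Longrightarrow> x \<in> lcarrier A" "lzero A \<in> S"
     "\<And>x y. x \<in> S \<Longrightarrow> y \<in> S \<Longrightarrow> ladd A x y \<in> S" "\<And>x a. x \<in> S \<Longrightarrow> lsmul A a x \<in> S"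
    using gs by (auto simp: graded_subspace_def subspace_def)
  have neg: "lneg A x \<in> S" if "x \<in> S" for x
    using S that by (simp add: neg_eq)
  have "vs (substr A S)"
    unfolding vs_def substr_simps
    by (intro conjI ballI allI)
      (simp_all add: S neg add_ac add_neg smul_add add_smul mul_smul)
  moreover have "graded (substr A S)"
    unfolding graded_def using comp_substr(2)[OF gs]
    by (auto simp: subspace_def S intro: deg_add deg_smul)
  ultimately show ?thesis
    unfolding lie_superalgebra_def substr_simps
    by (intro conjI ballI allI; (elim IntE)?)
      (assumption | (rule antisym_axiom, assumption+) | (rule jacobi_axiom, assumption+, erule S(1))
        | simp add: S br br_add_left br_add_right br_smul_left br_smul_right br_deg)+
qed

lemma graded_subspace_part: "graded_subspace A (part A P)"
  by (auto simp: graded_subspace_def subspace_def part_carrier part_add part_smul part_comp)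

lemma subalgebra_pos: "subalgebra A (part A (\<lambda>k. 1 \<le> k))"
proof -
  have "lbr A x y \<in> part A (\<lambda>k. 1 \<le> k)"
    if x: "x \<in> part A (\<lambda>k. 1 \<le> k)" and y: "y \<in> part A (\<lambda>k. 1 \<le> k)" for x y
  proof -
    have c: "x \<in> lcarrier A" "y \<in> lcarrier A" using x y by (auto intro: part_carrier)
    have *: "lbr A (comp A i x) (comp A j y) \<in> part A (\<lambda>k. 1 \<le> k)" for i j
    proof (cases "1 \<le> i \<and> 1 \<le> j")
      case True
      have "lbr A (comp A i x) (comp A j y) \<in> ldeg A (i + j)"
        using c by (intro br_deg) auto
      then show ?thesis by (rule part_deg) (use True in auto)
    next
      case False
      then show ?thesis using x y c by (auto simp: part_def)
    qed
    have "lbr A (comp A i x) y \<in> part A (\<lambda>k. 1 \<le> k)" for i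
      by (rule graded_induct[where Q = "\<lambda>v. lbr A (comp A i x) v \<in> part A (\<lambda>k. 1 \<le> k)", OF c(2)])
        (use c * in \<open>auto simp: br_add_right intro: part_add\<close>)
    then show ?thesis
      by (intro graded_induct[where Q = "\<lambda>v. lbr A v y \<in> part A (\<lambda>k. 1 \<le> k)", OF c(1)])
        (use c in \<open>auto simp: br_add_left intro: part_add\<close>)
  qed
  then show ?thesis by (simp add: subalgebra_def graded_subspace_part)
qed

end

section \<open>Images under operation-preserving surjections with graded kernel\<close>

locale lsa_epi = A: lsalg A for A :: "('k::field, 'a) lsa" +
  fixes B :: "('k, 'b) lsa" and f :: "'a \<Rightarrow> 'b"
  assumes carrier: "lcarrier B = f ` lcarrier A"
    and zero: "lzero B = f (lzero A)"
    and add: "\<And>x y. x \<in> lcarrier A \<Longrightarrow> y \<in> lcarrier A \<Longrightarrow> ladd B (f x) (f y) = f (ladd A x y)"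
    and neg: "\<And>x. x \<in> lcarrier A \<Longrightarrow> lneg B (f x) = f (lneg A x)"
    and smul: "\<And>a x. x \<in> lcarrier A \<Longrightarrow> lsmul B a (f x) = f (lsmul A a x)"
    and br: "\<And>x y. x \<in> lcarrier A \<Longrightarrow> y \<in> lcarrier A \<Longrightarrow> lbr B (f x) (f y) = f (lbr A x y)"
    and deg: "\<And>k. ldeg B k = f ` ldeg A k"
    and ker: "\<And>x k. x \<in> lcarrier A \<Longrightarrow> f x = f (lzero A) \<Longrightarrow> f (comp A k x) = f (lzero A)"
begin

lemma vs_image: "vs B"
  unfolding vs_def carrier zero ball_simps
  by (intro conjI ballI allI)
    (simp_all add: add neg smul A.add_ac A.add_neg A.smul_add A.add_smul A.mul_smul)

lemma lsum_image: "(\<And>k. c k \<in> lcarrier A) \<Longrightarrow> lsum B (\<lambda>k. f (c k)) ks = f (lsum A c ks)"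
  by (induction ks) (simp_all add: zero add)

lemma decomp_image:
  assumes "decomp A x c" shows "decomp B (f x) (\<lambda>k. f (c k))"
proof -
  obtain n where n: "\<And>k. k < - int n \<or> int n < k \<Longrightarrow> c k = lzero A"
     "lsum A c [- int n..int n] = x"
    using A.decomp_eventually[OF assms] by blast
  have c: "c k \<in> ldeg A k" "c k \<in> lcarrier A" for k
    using A.decomp_in_deg[OF assms] A.deg_carrier by blast+
  show ?thesis
    unfolding decomp_def deg zero using c n lsum_image[of c "[- int n..int n]"]
    by (intro conjI allI exI[of _ n]) auto
qed

lemma image_eqI:
  assumes "x \<in> lcarrier A" "y \<in> lcarrier A" "f (ladd A x (lsmul A (- 1) y)) = f (lzero A)"
  shows "f x = f y"
proof -
  have "f x = f (ladd A (ladd A x (lsmul A (- 1) y)) y)"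
    using A.add_diff_cancel[OF assms(1,2)] assms by (simp add: A.add_commute)
  also have "\<dots> = ladd B (f (lzero A)) (f y)"
    using assms by (simp add: add[symmetric])
  also have "\<dots> = f y" using assms by (simp add: add)
  finally show ?thesis .
qed

lemma image_diff:
  assumes "x \<in> lcarrier A" "y \<in> lcarrier A" "f x = f y"
  shows "f (ladd A x (lsmul A (- 1) y)) = f (lzero A)"
proof -
  have "f (ladd A x (lsmul A (- 1) y)) = ladd B (f x) (f (lsmul A (- 1) y))"
    using assms(1,2) by (simp add: add)
  also have "\<dots> = ladd B (f y) (f (lsmul A (- 1) y))"
    by (simp only: assms(3))
  also have "\<dots> = f (lzero A)"
    using assms(2) A.add_minus[of y] by (simp add: add)
  finally show ?thesis .
qed

text \<open>A decomposition in the image lifts to one of some \<open>y\<close> with the same image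
  as \<open>x\<close>. The difference of \<open>x\<close> and \<open>y\<close> lies in the kernel,
  and since the kernel is graded so do its components.\<close>

lemma decomp_image_unique:
  assumes "decomp B (f x) C" "x \<in> lcarrier A"
  shows "C k = f (comp A k x)"
proof -
  obtain n where n: "\<And>k. C k \<in> ldeg B k" "\<And>k. k < - int n \<or> int n < k \<Longrightarrow> C k = lzero B"
      "f x = lsum B C [- int n..int n]"
    using assms unfolding decomp_def by blast
  \<comment> \<open>Outside the cutoff the lift is taken to be zero itself; arbitrary
    representatives of zero there might give infinitely many nonzero terms.\<close>
  have "\<exists>c. c \<in> ldeg A k \<and> C k = f c \<and> (k < - int n \<or> int n < k \<longrightarrow> c = lzero A)" for k
    using n(1)[of k] n(2)[of k] by (cases "k < - int n \<or> int n < k") (auto simp: deg zero)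
  then obtain c where c: "\<And>k. c k \<in> ldeg A k" "\<And>k. C k = f (c k)"
      "\<And>k. k < - int n \<or> int n < k \<Longrightarrow> c k = lzero A"
    by metis
  have c': "\<And>k. c k \<in> lcarrier A" using c(1) A.deg_carrier by blast
  define y where "y = lsum A c [- int n..int n]"
  have y: "decomp A y c" unfolding y_def using c by (intro A.decompI) auto
  have y': "y \<in> lcarrier A" using A.decomp_carrier[OF y] .
  have "C = (\<lambda>k. f (c k))" using c by auto
  then have "f x = f y" using n(3) lsum_image[of c] c' by (simp add: y_def)
  then have "f (comp A k (ladd A x (lsmul A (- 1) y))) = f (lzero A)"
    using image_diff assms y' by (intro ker) auto
  then have "f (ladd A (comp A k x) (lsmul A (- 1) (c k))) = f (lzero A)"
    using assms y' A.comp_eqI[OF y] by simp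
  then show ?thesis using image_eqI[of "comp A k x" "c k"] assms c c' by auto
qed

lemma graded_image: "graded B"
  unfolding graded_def
proof (intro conjI allI ballI)
  show "Defs.subspace B (ldeg B k)" for k
    unfolding subspace_def deg zero carrier using A.deg_carrier
    by (auto simp: add smul intro!: imageI A.deg_add A.deg_smul)
  fix y assume "y \<in> lcarrier B"
  then obtain x where x: "y = f x" "x \<in> lcarrier A" by (auto simp: carrier)
  show "\<exists>!c. decomp B y c"
    unfolding x(1)
    by (intro ex1I[of "decomp B (f x)" "\<lambda>k. f (comp A k x)"] ext
        decomp_image[OF A.decomp_comp[OF x(2)]] decomp_image_unique[OF _ x(2)])
qed

lemma comp_image:
  assumes "x \<in> lcarrier A" shows "comp B k (f x) = f (comp A k x)"
  by (rule graded_vs.comp_eqI[OF graded_vs.intro[OF vs_image graded_image]])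
    (rule decomp_image[OF A.decomp_comp[OF assms]])

text \<open>Every axiom for \<open>B\<close> is the image under \<open>f\<close> of the same axiom
  for \<open>A\<close>. This serves both for copies along an injection and for quotient
  maps.\<close>

lemma lie_superalgebra_image: "lie_superalgebra B"
proof -
  have sneg: "sneg B e (f x) = f (sneg A e x)" if "x \<in> lcarrier A" for e x
    using that by (simp add: sneg_def neg)
  have snegc: "sneg A e x \<in> lcarrier A" if "x \<in> lcarrier A" for e x
    using that by (simp add: sneg_def)
  have anti: "lbr B (f x) (f y) = lneg B (sneg B (odd i \<and> odd j) (lbr B (f y) (f x)))"
    if "x \<in> ldeg A i" "y \<in> ldeg A j" for x y i j
    using that[THEN A.deg_carrier] A.antisym_axiom[OF that] by (simp add: br sneg snegc neg)
  have jac: "ladd B (lbr B (f x) (lbr B (f y) (f z)))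
        (lneg B (sneg B (odd i \<and> odd j) (lbr B (f y) (lbr B (f x) (f z)))))
      = lbr B (lbr B (f x) (f y)) (f z)"
    if "x \<in> ldeg A i" "y \<in> ldeg A j" "z \<in> lcarrier A" for x y z i j
    using that(1,2)[THEN A.deg_carrier] that(3) A.jacobi_axiom[OF that]
    by (simp add: br sneg snegc neg add)
  have deg': "lbr B (f x) (f y) \<in> f ` ldeg A (i + j)" if "x \<in> ldeg A i" "y \<in> ldeg A j" for x y i j
    using that[THEN A.deg_carrier] A.br_deg[OF that] by (simp add: br)
  show ?thesis
    unfolding lie_superalgebra_def carrier deg ball_simps
    by (intro conjI ballI allI vs_image graded_image)
      ((rule anti, assumption, assumption) | (rule jac, assumption+) | (rule deg', assumption+)
        | simp add: br add smul A.br_add_left A.br_add_right A.br_smul_left A.br_smul_right)+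
qed

end

section \<open>Quotients\<close>

lemma (in lsalg) comp_br:
  assumes u: "u \<in> ldeg A i" and x: "x \<in> lcarrier A"
  shows "comp A (i + k) (lbr A u x) = lbr A u (comp A k x)"
proof (rule graded_induct[where Q = "\<lambda>v. comp A (i + k) (lbr A u v) = lbr A u (comp A k v)", OF x])
  note uc = deg_carrier[OF u]
  show "comp A (i + k) (lbr A u (comp A j x)) = lbr A u (comp A k (comp A j x))" for j
    using comp_homogeneous[OF br_deg[OF u comp_deg[OF x, of j]]] uc x by auto
qed (use deg_carrier[OF u] in \<open>auto simp: br_add_right\<close>)

lemma (in lsalg) subalgebra_lie_span: "subalgebra A (lie_span A (ldeg A 1))"
  unfolding subalgebra_def graded_subspace_def subspace_def
  using lie_span_comp hspan_lie_span by (blast intro: lie_span.intros)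

text \<open>Freeness gives a homomorphism from the positive part into the subalgebra
  \<open>P\<close> generated by degree 1 that fixes the generators. Followed by the inclusion it
  must be the identity, by uniqueness, so the positive part is contained in
  \<open>P\<close>.\<close>

lemma (in lsalg) free_pos_generated:
  assumes "free_pos A"
  shows "pos_generated A"
proof -
  define P where "P = lie_span A (ldeg A 1)"
  define Ap where "Ap = part A (\<lambda>k. 1 \<le> k)"
  have P: "subalgebra A P" unfolding P_def by (rule subalgebra_lie_span)
  have PA: "x \<in> P \<Longrightarrow> x \<in> lcarrier A" for x
    using P by (auto simp: subalgebra_def graded_subspace_def subspace_def)
  have gens: "x \<in> P" if "x \<in> ldeg A 1" for x using that by (simp add: P_def lie_span.gen)
  have Ap: "subalgebra A Ap" unfolding Ap_def by (rule subalgebra_pos)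
  have Ap_ops: "x \<in> Ap \<Longrightarrow> x \<in> lcarrier A" "x \<in> Ap \<Longrightarrow> y \<in> Ap \<Longrightarrow> ladd A x y \<in> Ap"
    "x \<in> Ap \<Longrightarrow> y \<in> Ap \<Longrightarrow> lbr A x y \<in> Ap" "x \<in> Ap \<Longrightarrow> lsmul A a x \<in> Ap" for x y a
    using Ap by (auto simp: subalgebra_def graded_subspace_def subspace_def)
  have A1: "ldeg A 1 \<subseteq> Ap" unfolding Ap_def using part_deg by auto
  have "\<exists>!h. h \<in> extensional Ap \<and> lsa_hom (substr A Ap) (substr A P) h \<and> (\<forall>u\<in>ldeg A 1. h u = u)"
    unfolding Ap_def
    by (rule assms[unfolded free_pos_def, rule_format, of "substr A P" "\<lambda>u. u"])
      (use lie_superalgebra_substr[OF P] gens in auto)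
  then obtain h where h: "h \<in> extensional Ap" "lsa_hom (substr A Ap) (substr A P) h"
      "\<forall>u\<in>ldeg A 1. h u = u" by blast
  have "lsa_hom (substr A Ap) A h"
    using h(2) PA unfolding lsa_hom_def by auto
  \<comment> \<open>Uniqueness in \<open>free_pos\<close> is among extensional maps, hence the
    identity in its restricted form.\<close>
  moreover have "lsa_hom (substr A Ap) A (restrict (\<lambda>x. x) Ap)"
    using Ap_ops by (auto simp: lsa_hom_def)
  moreover have "\<exists>!h. h \<in> extensional Ap \<and> lsa_hom (substr A Ap) A h \<and> (\<forall>u\<in>ldeg A 1. h u = u)"
    unfolding Ap_def
    by (rule assms[unfolded free_pos_def, rule_format, of A "\<lambda>u. u"]) (use lie in auto)
  moreover have "\<forall>u\<in>ldeg A 1. restrict (\<lambda>x. x) Ap u = u" using A1 by auto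
  ultimately have "h = restrict (\<lambda>x. x) Ap"
    using h restrict_extensional by blast
  then have "x \<in> P" if "x \<in> Ap" for x
    using h(2) that by (simp add: lsa_hom_def)
  then show ?thesis by (intro pos_generatedI) (simp add: P_def Ap_def)
qed

section \<open>The quotient of a subalgebra by an ideal\<close>

lemma quot_simps [simp]:
  "lcarrier (quot A S D) = coset A D ` S" "lzero (quot A S D) = coset A D (lzero A)"
  "ldeg (quot A S D) k = coset A D ` (S \<inter> ldeg A k)"
  by (simp_all add: quot_def)

locale lsa_quot = lsalg A for A :: "('k::field, 'a) lsa" +
  fixes S D
  assumes sub: "subalgebra A S" and ideal: "ideal A S D"
begin

lemma S_carrier: "x \<in> S \<Longrightarrow> x \<in> lcarrier A"
  and S_zero: "lzero A \<in> S"
  and S_add: "x \<in> S \<Longrightarrow> y \<in> S \<Longrightarrow> ladd A x y \<in> S"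
  and S_smul: "x \<in> S \<Longrightarrow> lsmul A a x \<in> S"
  and S_br: "x \<in> S \<Longrightarrow> y \<in> S \<Longrightarrow> lbr A x y \<in> S"
  and S_comp: "x \<in> S \<Longrightarrow> comp A k x \<in> S"
  using sub by (auto simp: subalgebra_def graded_subspace_def subspace_def)

lemma D_S: "d \<in> D \<Longrightarrow> d \<in> S"
  and D_zero: "lzero A \<in> D"
  and D_add: "x \<in> D \<Longrightarrow> y \<in> D \<Longrightarrow> ladd A x y \<in> D"
  and D_smul: "x \<in> D \<Longrightarrow> lsmul A a x \<in> D"
  and D_br: "x \<in> S \<Longrightarrow> d \<in> D \<Longrightarrow> lbr A x d \<in> D"
  and D_comp: "d \<in> D \<Longrightarrow> comp A k d \<in> D"
  using ideal by (auto simp: ideal_def graded_subspace_def subspace_def)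

lemma D_carrier: "d \<in> D \<Longrightarrow> d \<in> lcarrier A"
  using D_S S_carrier by blast

text \<open>\<open>ideal\<close> asks for brackets with the ideal element on the right. Since
  \<open>S\<close> and \<open>D\<close> are graded, antisymmetry transfers this to the left on
  components, and additivity does the rest.\<close>

lemma D_br_left:
  assumes "d \<in> D" "x \<in> S" shows "lbr A d x \<in> D"
proof -
  note c = D_carrier[OF assms(1)] S_carrier[OF assms(2)]
  have *: "lbr A (comp A i d) (comp A j x) \<in> D" for i j
    using antisym[of "comp A i d" i "comp A j x" j] c assms
    by (simp add: D_smul D_br S_comp D_comp)
  have "lbr A (comp A i d) x \<in> D" for i
    by (rule graded_induct[where Q = "\<lambda>v. lbr A (comp A i d) v \<in> D", OF c(2)])
      (use c * in \<open>auto simp: br_add_right D_zero intro: D_add\<close>)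
  then show ?thesis
    by (intro graded_induct[where Q = "\<lambda>v. lbr A v x \<in> D", OF c(1)])
      (use c in \<open>auto simp: br_add_left D_zero intro: D_add\<close>)
qed

lemma coset_add_D:
  assumes "x \<in> lcarrier A" "d \<in> D" shows "coset A D (ladd A x d) = coset A D x"
proof -
  have "ladd A (ladd A x d) e \<in> coset A D x" if "e \<in> D" for e
    using that assms D_carrier by (auto simp: coset_def add_assoc intro!: D_add)
  moreover have "ladd A x e \<in> coset A D (ladd A x d)" if "e \<in> D" for e
  proof -
    have "ladd A x e = ladd A (ladd A x d) (ladd A e (lsmul A (- 1) d))"
      using that assms D_carrier add_diff_cancel[of e d] by (simp add: add_assoc)
    then show ?thesis using that assms by (auto simp: coset_def intro!: D_add D_smul)
  qed
  ultimately show ?thesis unfolding coset_def by blast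
qed

lemma coset_eqD:
  assumes "x \<in> lcarrier A" "y \<in> lcarrier A" "coset A D x = coset A D y"
  shows "ladd A x (lsmul A (- 1) y) \<in> D"
proof -
  have "x \<in> coset A D x" using assms(1) D_zero by (force simp: coset_def)
  then obtain d where d: "d \<in> D" "x = ladd A y d" using assms(3) by (auto simp: coset_def)
  have "ladd A y (ladd A x (lsmul A (- 1) y)) = ladd A y d"
    using d add_diff_cancel[OF assms(1,2)] by simp
  then show ?thesis
    using d assms D_carrier add_left_cancel[of y "ladd A x (lsmul A (- 1) y)" d] by simp
qed

lemma coset_eqI:
  assumes "x \<in> lcarrier A" "y \<in> lcarrier A" "ladd A x (lsmul A (- 1) y) \<in> D"
  shows "coset A D x = coset A D y"
  using coset_add_D[OF assms(2,3)] add_diff_cancel[OF assms(1,2)] by simp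

lemma coset_zero_iff: "x \<in> lcarrier A \<Longrightarrow> coset A D x = coset A D (lzero A) \<longleftrightarrow> x \<in> D"
  using coset_eqD[of x "lzero A"] coset_eqI[of x "lzero A"] by auto

text \<open>The operations of \<open>quot\<close> act on representatives picked by
  \<open>SOME\<close>. All that is known of a pick is that it differs from \<open>x\<close> by an
  element of \<open>D\<close>, and this suffices for independence of the choice.\<close>

lemma some_coset:
  assumes "x \<in> S" obtains d where "d \<in> D" "(SOME y. y \<in> coset A D x) = ladd A x d"
proof -
  have "(SOME y. y \<in> coset A D x) \<in> coset A D x"
    by (rule someI[of _ "ladd A x (lzero A)"]) (use D_zero in \<open>auto simp: coset_def\<close>)
  then show thesis using that by (auto simp: coset_def)
qed

lemma quot_add:
  assumes "x \<in> S" "y \<in> S"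
  shows "ladd (quot A S D) (coset A D x) (coset A D y) = coset A D (ladd A x y)"
proof -
  obtain d where d: "d \<in> D" "(SOME z. z \<in> coset A D x) = ladd A x d" using some_coset[OF assms(1)] .
  obtain e where e: "e \<in> D" "(SOME z. z \<in> coset A D y) = ladd A y e" using some_coset[OF assms(2)] .
  note c [simp] = assms[THEN S_carrier] d(1)[THEN D_carrier] e(1)[THEN D_carrier]
  have "ladd A (ladd A x d) (ladd A y e) = ladd A (ladd A x y) (ladd A d e)"
    by (simp add: add_ac)
  then show ?thesis using d e by (simp add: quot_def coset_add_D D_add)
qed

lemma quot_smul:
  assumes "x \<in> S"
  shows "lsmul (quot A S D) a (coset A D x) = coset A D (lsmul A a x)"
proof -
  obtain d where d: "d \<in> D" "(SOME z. z \<in> coset A D x) = ladd A x d" using some_coset[OF assms(1)] .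
  note c [simp] = assms[THEN S_carrier] d(1)[THEN D_carrier]
  show ?thesis using d by (simp add: quot_def smul_add coset_add_D D_smul)
qed

lemma quot_neg:
  assumes "x \<in> S"
  shows "lneg (quot A S D) (coset A D x) = coset A D (lneg A x)"
proof -
  obtain d where d: "d \<in> D" "(SOME z. z \<in> coset A D x) = ladd A x d" using some_coset[OF assms(1)] .
  note c [simp] = assms[THEN S_carrier] d(1)[THEN D_carrier]
  show ?thesis using d by (simp add: quot_def neg_eq smul_add coset_add_D D_smul)
qed

lemma quot_br:
  assumes "x \<in> S" "y \<in> S"
  shows "lbr (quot A S D) (coset A D x) (coset A D y) = coset A D (lbr A x y)"
proof -
  obtain d where d: "d \<in> D" "(SOME z. z \<in> coset A D x) = ladd A x d" using some_coset[OF assms(1)] .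
  obtain e where e: "e \<in> D" "(SOME z. z \<in> coset A D y) = ladd A y e" using some_coset[OF assms(2)] .
  note c [simp] = assms[THEN S_carrier] d(1)[THEN D_carrier] e(1)[THEN D_carrier]
  \<comment> \<open>After expansion, every term other than \<open>lbr A x y\<close> has a factor in
    \<open>D\<close>.\<close>
  have "lbr A (ladd A x d) (ladd A y e)
      = ladd A (lbr A x y) (ladd A (lbr A x e) (ladd A (lbr A d y) (lbr A d e)))"
    by (simp add: br_add_left br_add_right add_ac)
  moreover have "ladd A (lbr A x e) (ladd A (lbr A d y) (lbr A d e)) \<in> D"
    using assms d e D_S by (intro D_add D_br D_br_left) auto
  ultimately show ?thesis using d e by (simp add: quot_def coset_add_D)
qed

text \<open>The kernel of the projection is \<open>D\<close>, which is graded; the axioms and the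
  components of the quotient thus come from the results on images.\<close>

lemma quot_epi: "lsa_epi (substr A S) (quot A S D) (coset A D)"
proof (intro lsa_epi.intro lsalgI lie_superalgebra_substr sub lsa_epi_axioms.intro)
  have gs: "graded_subspace A S" using sub by (simp add: subalgebra_def)
  show "coset A D (comp (substr A S) k x) = coset A D (lzero (substr A S))"
    if "x \<in> lcarrier (substr A S)" "coset A D x = coset A D (lzero (substr A S))" for x k
    using that comp_substr(1)[OF gs] S_carrier D_comp by (simp add: coset_zero_iff)
qed (auto simp: quot_add quot_smul quot_neg quot_br)

lemma lie_superalgebra_quot: "lie_superalgebra (quot A S D)"
  using lsa_epi.lie_superalgebra_image[OF quot_epi] .

lemma comp_quot:
  assumes "x \<in> S" shows "comp (quot A S D) k (coset A D x) = coset A D (comp A k x)"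
proof -
  have gs: "graded_subspace A S" using sub by (simp add: subalgebra_def)
  show ?thesis
    using lsa_epi.comp_image[OF quot_epi, of x k] comp_substr(1)[OF gs assms] assms by simp
qed

lemma quot_lie_span:
  assumes "x \<in> lie_span A (ldeg A 1)" "ldeg A 1 \<subseteq> S"
  shows "x \<in> S \<and> coset A D x \<in> lie_span (quot A S D) (ldeg (quot A S D) 1)"
  using assms(1)
proof (induction rule: lie_span.induct)
  case (gen x)
  then show ?case using assms(2) by (auto intro!: lie_span.gen)
next
  case zero
  then show ?case using lie_span.zero[of "quot A S D"] S_zero by simp
next
  case (add x y)
  then show ?case using lie_span.add[of "coset A D x" "quot A S D" _ "coset A D y"]
    by (simp add: S_add quot_add)
next
  case (smul x a)
  then show ?case using lie_span.smul[of "coset A D x" "quot A S D" _ a]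
    by (simp add: S_smul quot_smul)
next
  case (br x y)
  then show ?case using lie_span.br[of "coset A D x" "quot A S D" _ "coset A D y"]
    by (simp add: S_br quot_br)
qed

text \<open>Because \<open>D\<close> starts in degree 2, the projection loses nothing in degrees at
  most 1.\<close>

lemma comp_eq_zero_of_quot:
  assumes "D \<subseteq> part A (\<lambda>k. 2 \<le> k)" "x \<in> S" "k \<le> 1" "coset A D (comp A k x) = coset A D (lzero A)"
  shows "comp A k x = lzero A"
proof -
  have x: "x \<in> lcarrier A" using assms S_carrier by auto
  have "comp A k x \<in> D" using assms x by (simp add: coset_zero_iff)
  then have "comp A k (comp A k x) = lzero A"
    using assms(1,3) by (auto simp: part_def)
  then show ?thesis using x by simp
qed

lemma pos_generated_quot:
  assumes "pos_generated A" "part A (\<lambda>k. 1 \<le> k) \<subseteq> S" "D \<subseteq> part A (\<lambda>k. 2 \<le> k)"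
  shows "pos_generated (quot A S D)"
proof (rule lsalg.pos_generatedI[OF lsalgI[OF lie_superalgebra_quot]])
  fix X assume X: "X \<in> part (quot A S D) (\<lambda>k. 1 \<le> k)"
  then obtain x where x: "x \<in> S" "X = coset A D x" by (auto simp: part_def)
  have "comp A k x = lzero A" if "\<not> 1 \<le> k" for k
    using X that x comp_eq_zero_of_quot[OF assms(3) x(1), of k] comp_quot[OF x(1), of k]
    by (simp add: part_def)
  then have "x \<in> part A (\<lambda>k. 1 \<le> k)" using x S_carrier by (simp add: part_def)
  then have "x \<in> lie_span A (ldeg A 1)" using assms(1) by (simp add: pos_generated_def)
  then show "X \<in> lie_span (quot A S D) (ldeg (quot A S D) 1)"
    unfolding x(2) using quot_lie_span part_deg[of _ 1 "\<lambda>k. 1 \<le> k"] assms(2) by blast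
qed

text \<open>The hypothesis \<open>inj\<close> says that brackets with degree 1 detect elements of
  nonpositive degree. Such brackets land in degrees at most 1, out of reach of \<open>D\<close>, so
  detection survives in the quotient.\<close>

lemma pos_0_transitive_quot:
  assumes inj: "\<And>k x. k \<le> 0 \<Longrightarrow> x \<in> ldeg A k \<Longrightarrow> (\<And>u. u \<in> ldeg A 1 \<Longrightarrow> lbr A x u = lzero A) \<Longrightarrow> x = lzero A"
    and S: "part A (\<lambda>k. 1 \<le> k) \<subseteq> S" and D: "D \<subseteq> part A (\<lambda>k. 2 \<le> k)"
  shows "pos_0_transitive (quot A S D)"
  unfolding pos_0_transitive_def
proof (intro ballI impI)
  let ?Q = "quot A S D"
  interpret Q: lsalg ?Q by (rule lsalgI[OF lie_superalgebra_quot])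
  fix X assume X: "X \<in> part ?Q (\<lambda>k. k \<le> 0)"
    and central: "\<forall>Y\<in>part ?Q (\<lambda>k. 1 \<le> k). lbr ?Q Y X = lzero ?Q"
  obtain x where x: "x \<in> S" "X = coset A D x" using X by (auto simp: part_def)
  have xc: "x \<in> lcarrier A" using x S_carrier by auto
  have pos: "coset A D (comp A k x) = coset A D (lzero A)" if "\<not> k \<le> 0" for k
    using X that x comp_quot[OF x(1), of k] by (auto simp: part_def)
  have nonpos: "comp A k x = lzero A" if "k \<le> 0" for k
  proof (rule inj[OF that])
    show "comp A k x \<in> ldeg A k" using xc by simp
    fix u assume u: "u \<in> ldeg A 1"
    have uS: "u \<in> S" "u \<in> lcarrier A"
      using u S part_deg[of u 1 "\<lambda>k. 1 \<le> k"] deg_carrier by auto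
    have "coset A D u \<in> ldeg ?Q 1" using u uS by simp
    then have "lbr ?Q (coset A D u) X = lzero ?Q"
      using central Q.part_deg[of "coset A D u" 1 "\<lambda>k. 1 \<le> k"] by simp
    then have "lbr A u x \<in> D"
      using x uS xc by (simp add: quot_br coset_zero_iff)
    \<comment> \<open>Since \<open>k \<le> 0\<close>, the degree \<open>1 + k\<close> is at most 1,
      where elements of \<open>D\<close> have zero component.\<close>
    then have "comp A (1 + k) (lbr A u x) = lzero A"
      using D that by (auto simp: part_def)
    moreover have "comp A (1 + k) (lbr A u x) = lbr A u (comp A k x)"
      by (rule comp_br[OF u xc])
    ultimately have "lbr A u (comp A k x) = lzero A" by simp
    then show "lbr A (comp A k x) u = lzero A"
      using antisym[of "comp A k x" k u 1] u xc by simp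
  qed
  \<comment> \<open>The positive components of \<open>x\<close> lie in \<open>D\<close> because
    \<open>X\<close> is nonpositive, while the other ones have just been shown to vanish.\<close>
  have "coset A D (comp A k x) = coset A D (lzero A)" for k
    using pos nonpos by (cases "k \<le> 0") auto
  then have "comp A k x \<in> D" for k
    using xc by (simp add: coset_zero_iff)
  then have "x \<in> D"
    by (intro graded_induct[where Q = "\<lambda>v. v \<in> D", OF xc]) (auto simp: D_zero intro: D_add)
  then show "X = lzero ?Q" using x xc by (simp add: coset_zero_iff)
qed

end

section \<open>Lifting along the free positive part\<close>

text \<open>A countable exhaustion of the span. Each stage is written with images of products, which
  is the shape that the cardinality estimates handle.\<close>

primrec lie_layer :: "('k, 'a) lsa \<Rightarrow> 'a set \<Rightarrow> nat \<Rightarrow> 'a set" where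
  "lie_layer A X 0 = insert (lzero A) X"
| "lie_layer A X (Suc n) = lie_layer A X n \<union>
     ((\<lambda>(x, y). ladd A x y) ` (lie_layer A X n \<times> lie_layer A X n) \<union>
     ((\<lambda>(a, x). lsmul A a x) ` (UNIV \<times> lie_layer A X n) \<union>
      (\<lambda>(x, y). lbr A x y) ` (lie_layer A X n \<times> lie_layer A X n)))"

lemma lie_layer_mono: "m \<le> n \<Longrightarrow> lie_layer A X m \<subseteq> lie_layer A X n"
  by (rule lift_Suc_mono_le) auto

lemma lie_span_subset_layers: "lie_span A X \<subseteq> (\<Union>n. lie_layer A X n)"
proof
  have step: "\<exists>n. x \<in> lie_layer A X n \<and> y \<in> lie_layer A X n"
    if "x \<in> lie_layer A X m" "y \<in> lie_layer A X m'" for x y m m'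
    using that lie_layer_mono[of m "max m m'" A X] lie_layer_mono[of m' "max m m'" A X] by auto
  fix x assume "x \<in> lie_span A X"
  then show "x \<in> (\<Union>n. lie_layer A X n)"
  proof (induction rule: lie_span.induct)
    case (gen x)
    then have "x \<in> lie_layer A X 0" by simp
    then show ?case by blast
  next
    case zero
    have "lzero A \<in> lie_layer A X 0" by simp
    then show ?case by blast
  next
    case (add x y)
    then obtain n where "x \<in> lie_layer A X n" "y \<in> lie_layer A X n" using step by blast
    then have "ladd A x y \<in> lie_layer A X (Suc n)" by force
    then show ?case by blast
  next
    case (smul x a)
    then obtain n where "x \<in> lie_layer A X n" by blast
    then have "lsmul A a x \<in> lie_layer A X (Suc n)" by force
    then show ?case by blast
  next
    case (br x y)
    then obtain n where "x \<in> lie_layer A X n" "y \<in> lie_layer A X n" using step by blast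
    then have "lbr A x y \<in> lie_layer A X (Suc n)" by force
    then show ?case by blast
  qed
qed

text \<open>An infinite cardinal absorbs binary unions, products with sets that are not larger (here
  the scalars and the layer itself) and countable unions. So no layer, and not their union either,
  exceeds \<open>X\<close>.\<close>

lemma card_lie_span:
  includes cardinal_syntax
  fixes A :: "('k, 'a) lsa"
  assumes inf: "infinite X" and K: "|UNIV :: 'k set| \<le>o |X|"
  shows "|lie_span A X| \<le>o |X|"
proof -
  have un: "|B \<union> C| \<le>o |X|" if "|B| \<le>o |X|" "|C| \<le>o |X|" for B C :: "'a set"
    by (rule card_of_Un_ordLeq_infinite_Field[OF _ that card_of_Card_order])
      (simp add: inf Field_card_of)
  have layer: "|lie_layer A X n| \<le>o |X|" for n
  proof (induction n)
    case 0
    have "|{lzero A} \<union> X| \<le>o |X|"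
      using inf by (intro un card_of_singl_ordLeq card_of_mono1) auto
    then show ?case by simp
  next
    case (Suc n)
    have img: "|f ` (B \<times> lie_layer A X n)| \<le>o |X|" if "|B| \<le>o |X|" for f :: "'b \<times> 'a \<Rightarrow> 'a" and B
      by (rule ordLeq_transitive[OF card_of_image card_of_Sigma_ordLeq_infinite[OF inf that]])
        (simp add: Suc)
    show ?case
      unfolding lie_layer.simps
      by (intro un Suc img K)
  qed
  have "|\<Union>n. lie_layer A X n| \<le>o |X|"
    by (rule card_of_UNION_ordLeq_infinite[OF inf])
      (use inf layer in \<open>auto simp: infinite_iff_card_of_nat\<close>)
  then show ?thesis
    using card_of_mono1[OF lie_span_subset_layers] ordLeq_transitive by blast
qed

text \<open>A structure generated in degree 1 is no larger than its degree-1 space, so it can be moved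
  into any type that accommodates the latter; this is what makes the universal property, which only
  quantifies over structures on one type, applicable to it.\<close>
lemma (in lsalg) ex_embedding_pos:
  includes cardinal_syntax
  fixes j :: "'a \<Rightarrow> 'u"
  assumes K: "infinite (UNIV :: 'k set)" and gen: "pos_generated A" and j: "inj_on j (ldeg A 1)"
  shows "\<exists>i :: 'a \<Rightarrow> 'u. inj_on i (part A (\<lambda>k. 1 \<le> k))"
proof (cases "ldeg A 1 = {lzero A}")
  \<comment> \<open>Here degree 1 is finite and the cardinality bound does not apply, but everything
    generated by it is zero.\<close>
  case True
  have "x = lzero A" if "x \<in> lie_span A (ldeg A 1)" for x
    using that by induction (use True in auto)
  then have "part A (\<lambda>k. 1 \<le> k) \<subseteq> {lzero A}"
    using gen by (auto simp: pos_generated_def)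
  then show ?thesis by (intro exI[of _ "\<lambda>_. undefined"] inj_onI) blast
next
  case False
  then obtain x where x: "x \<in> ldeg A 1" "x \<noteq> lzero A" using deg_zero by blast
  have xc: "x \<in> lcarrier A" using x deg_carrier by blast
  \<comment> \<open>The line through a nonzero vector is a copy of the field inside degree 1, which
    makes degree 1 infinite and at least as large as the field.\<close>
  have inj: "inj (\<lambda>a. lsmul A a x)"
  proof (rule injI, rule ccontr)
    fix a b assume eq: "lsmul A a x = lsmul A b x" and "a \<noteq> b"
    have "lsmul A (a - b) x = lzero A"
      using add_smul[OF xc, of a "- b"] add_smul[OF xc, of b "- b", symmetric] xc
      unfolding eq by simp
    then have "lsmul A (inverse (a - b) * (a - b)) x = lzero A"
      using xc by (simp add: mul_smul)
    then show False using x xc \<open>a \<noteq> b\<close> by simp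
  qed
  have sub: "range (\<lambda>a. lsmul A a x) \<subseteq> ldeg A 1" using x deg_smul by auto
  have "|UNIV :: 'k set| \<le>o |ldeg A 1|"
    by (rule iffD1[OF card_of_ordLeq exI]) (rule conjI[OF inj sub])
  moreover have "infinite (ldeg A 1)"
    using infinite_super[OF sub] finite_image_iff[OF inj] K by simp
  ultimately have "|part A (\<lambda>k. 1 \<le> k)| \<le>o |ldeg A 1|"
    using card_lie_span[of "ldeg A 1" A] gen by (simp add: pos_generated_def)
  moreover have "|ldeg A 1| \<le>o |UNIV :: 'u set|"
    by (rule iffD1[OF card_of_ordLeq exI]) (rule conjI[OF j subset_UNIV])
  ultimately have "|part A (\<lambda>k. 1 \<le> k)| \<le>o |UNIV :: 'u set|"
    by (rule ordLeq_transitive)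
  then show ?thesis using iffD2[OF card_of_ordLeq] by metis
qed

section \<open>Transport of structure and the homomorphism from U_+ to G\<close>

definition transport :: "('k, 'a) lsa \<Rightarrow> ('a \<Rightarrow> 'b) \<Rightarrow> ('k, 'b) lsa" where
  "transport A i = (let r = inv_into (lcarrier A) i in
     \<lparr> lcarrier = i ` lcarrier A, lzero = i (lzero A),
       ladd = (\<lambda>x y. i (ladd A (r x) (r y))), lneg = (\<lambda>x. i (lneg A (r x))),
       lsmul = (\<lambda>a x. i (lsmul A a (r x))), ldeg = (\<lambda>k. i ` ldeg A k),
       lbr = (\<lambda>x y. i (lbr A (r x) (r y))) \<rparr>)"

lemma (in lsalg) transport_epi:
  assumes "inj_on i (lcarrier A)"
  shows "lsa_epi A (transport A i) i"
proof unfold_locales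
  fix x k assume "x \<in> lcarrier A" "i x = i (lzero A)"
  then have "x = lzero A" using assms by (simp add: inj_on_eq_iff)
  then show "i (comp A k x) = i (lzero A)" by simp
qed (simp_all add: transport_def Let_def assms)

text \<open>The test structures in \<open>free_pos\<close> live on the type of U, so G_+ is first
  copied into that type. The universal property is applied to the copy \<open>L\<close>, and the
  resulting map is carried back by the inverse \<open>r\<close> of the copying injection.\<close>

lemma free_pos_lift:
  fixes G :: "('k::field, 'g) lsa" and U :: "('k, 'u) lsa"
  assumes K: "infinite (UNIV :: 'k set)" and "lsalg G" "lsalg U" and gen: "pos_generated G"
    and free: "free_pos U" and j: "bij_betw j (ldeg G 1) (ldeg U 1)"
    and jadd: "\<And>u v. u \<in> ldeg G 1 \<Longrightarrow> v \<in> ldeg G 1 \<Longrightarrow> j (ladd G u v) = ladd U (j u) (j v)"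
    and jsmul: "\<And>a u. u \<in> ldeg G 1 \<Longrightarrow> j (lsmul G a u) = lsmul U a (j u)"
  shows "\<exists>\<psi>. lsa_hom (substr U (part U (\<lambda>k. 1 \<le> k))) G \<psi> \<and> (\<forall>u\<in>ldeg G 1. \<psi> (j u) = u)"
proof -
  interpret G: lsalg G by fact
  interpret U: lsalg U by fact
  let ?P = "part G (\<lambda>k. 1 \<le> k)"
  let ?Q = "part U (\<lambda>k. 1 \<le> k)"
  have G1: "ldeg G 1 \<subseteq> ?P" using G.part_deg by auto
  obtain i :: "'g \<Rightarrow> 'u" where i: "inj_on i ?P"
    using G.ex_embedding_pos[OF K gen bij_betw_imp_inj_on[OF j]] by blast
  define L where "L = transport (substr G ?P) i"
  interpret P: lsalg "substr G ?P"
    by (rule lsalgI[OF G.lie_superalgebra_substr[OF G.subalgebra_pos]])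
  interpret L: lsa_epi "substr G ?P" L i
    unfolding L_def by (rule P.transport_epi) (simp add: i)
  \<comment> \<open>The prescribed map on generators goes back to G_1 along \<open>j\<close> and
    then into the copy along \<open>i\<close>.\<close>
  define f where "f u = i (inv_into (ldeg G 1) j u)" for u
  have fj: "f (j u) = i u" if "u \<in> ldeg G 1" for u
    using that bij_betw_inv_into_left[OF j] by (simp add: f_def)
  have j_img: "ldeg U 1 = j ` ldeg G 1" using j by (simp add: bij_betw_def)
  have "\<exists>!h. h \<in> extensional ?Q \<and> lsa_hom (substr U ?Q) L h \<and> (\<forall>u\<in>ldeg U 1. h u = f u)"
  proof (rule free[unfolded free_pos_def, rule_format])
    show "lie_superalgebra L" by (rule L.lie_superalgebra_image)
    show "f u \<in> ldeg L 1" if "u \<in> ldeg U 1" for u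
      using that G1 by (auto simp: j_img fj L.deg)
    show "f (ladd U u v) = ladd L (f u) (f v)" if "u \<in> ldeg U 1" "v \<in> ldeg U 1" for u v
      using that L.add G.deg_add by (auto simp: j_img fj jadd[symmetric] subsetD[OF G1])
    show "f (lsmul U a u) = lsmul L a (f u)" if "u \<in> ldeg U 1" for u a
      using that L.smul G.deg_smul by (auto simp: j_img fj jsmul[symmetric] subsetD[OF G1])
  qed
  then obtain h where h: "lsa_hom (substr U ?Q) L h" "\<forall>u\<in>ldeg U 1. h u = f u" by blast
  define r where "r = inv_into ?P i"
  have r: "r (i x) = x" if "x \<in> ?P" for x using i that by (simp add: r_def)
  have hP: "\<exists>x\<in>?P. h w = i x" if "w \<in> ?Q" for w
    using h(1) that by (auto simp: lsa_hom_def L.carrier)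
  have Padd: "ladd G x y \<in> ?P" if "x \<in> ?P" "y \<in> ?P" for x y
    using that P.add_closed by simp
  have Psmul: "lsmul G a x \<in> ?P" if "x \<in> ?P" for x a
    using that P.smul_closed by simp
  have Pbr: "lbr G x y \<in> ?P" if "x \<in> ?P" "y \<in> ?P" for x y
    using that P.br_closed by simp
  have "lsa_hom (substr U ?Q) G (\<lambda>w. r (h w))"
    unfolding lsa_hom_def substr_simps
  proof (intro conjI ballI allI subsetI)
    show "r (h w) \<in> lcarrier G" if "w \<in> ?Q" for w
      using hP[OF that] r G.part_carrier by auto
    show "r (h (ladd U w w')) = ladd G (r (h w)) (r (h w'))" if "w \<in> ?Q" "w' \<in> ?Q" for w w'
    proof -
      have "h (ladd U w w') = ladd L (h w) (h w')" using h(1) that by (simp add: lsa_hom_def)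
      then show ?thesis using hP[OF that(1)] hP[OF that(2)] L.add r Padd by auto
    qed
    show "r (h (lsmul U a w)) = lsmul G a (r (h w))" if "w \<in> ?Q" for w a
    proof -
      have "h (lsmul U a w) = lsmul L a (h w)" using h(1) that by (simp add: lsa_hom_def)
      then show ?thesis using hP[OF that(1)] L.smul r Psmul by auto
    qed
    show "r (h (lbr U w w')) = lbr G (r (h w)) (r (h w'))" if "w \<in> ?Q" "w' \<in> ?Q" for w w'
    proof -
      have "h (lbr U w w') = lbr L (h w) (h w')" using h(1) that by (simp add: lsa_hom_def)
      then show ?thesis using hP[OF that(1)] hP[OF that(2)] L.br r Pbr by auto
    qed
    show "x \<in> ldeg G k" if x: "x \<in> (\<lambda>w. r (h w)) ` (ldeg U k \<inter> ?Q)" for x k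
    proof -
      obtain w where w: "w \<in> ldeg U k \<inter> ?Q" "x = r (h w)" using x by blast
      then have "h w \<in> ldeg L k" using h(1) unfolding lsa_hom_def substr_simps by blast
      then show ?thesis using w r by (auto simp: L.deg)
    qed
  qed
  moreover have "\<forall>u\<in>ldeg G 1. r (h (j u)) = u"
    using h(2) fj r G1 by (auto simp: j_img)
  ultimately show ?thesis by blast
qed

section \<open>Embedding the non-positive part\<close>

text \<open>The bracket with \<open>x\<close> is a superderivation, so if it kills degree 1 it kills
  all that degree 1 generates, that is the whole positive part; transitivity then applies.\<close>

lemma (in lsalg) central_nonpos_zero:
  assumes trans: "pos_0_transitive A" and gen: "pos_generated A" and k: "k \<le> 0" and x: "x \<in> ldeg A k"
    and central: "\<And>u. u \<in> ldeg A 1 \<Longrightarrow> lbr A x u = lzero A"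
  shows "x = lzero A"
proof -
  have xc: "x \<in> lcarrier A" using x deg_carrier by blast
  have *: "lbr A x w = lzero A" if "hspan A i w" for i w
    using that
  proof induction
    case (add k w w')
    then show ?case using xc hspan_carrier by (simp add: br_add_right)
  next
    case (smul k w a)
    then show ?case using xc hspan_carrier by (simp add: br_smul_right)
  next
    case (br i w i' w')
    then show ?case
      using br_derivation[OF x hspan_deg[OF br(1)] hspan_carrier[OF br(2)]]
        hspan_carrier[OF br(1)] hspan_carrier[OF br(2)] by simp
  qed (use xc central in auto)
  have "lbr A y x = lzero A" if y: "y \<in> part A (\<lambda>k. 1 \<le> k)" for y
  proof -
    have yc: "y \<in> lcarrier A" using y part_carrier by blast
    have "lbr A (comp A i y) x = lzero A" for i
    proof (cases "1 \<le> i")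
      case True
      have "lbr A x (comp A i y) = lzero A"
        by (rule *[OF pos_generated_hspan[OF gen True comp_deg[OF yc]]])
      then show ?thesis using antisym[OF comp_deg[OF yc] x, of i] by simp
    next
      case False
      then show ?thesis using y xc by (simp add: part_def)
    qed
    then show ?thesis
      by (intro graded_induct[where Q = "\<lambda>v. lbr A v x = lzero A", OF yc])
        (use xc in \<open>simp_all add: br_add_left\<close>)
  qed
  then show ?thesis
    using trans part_deg[OF x, of "\<lambda>k. k \<le> 0"] k by (simp add: pos_0_transitive_def)
qed

text \<open>Freeness of U_+ is represented here by two consequences: generation in degree 1
  (\<open>genU\<close>) and the homomorphism \<open>\<psi>\<close> that inverts \<open>j\<close> on
  generators.\<close>

locale universal_rel = G: lsalg G + U: lsalg U
  for G :: "('k::field, 'g) lsa" and U :: "('k, 'u) lsa" +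
  fixes j :: "'g \<Rightarrow> 'u" and \<psi> :: "'u \<Rightarrow> 'g"
  assumes trans: "pos_0_transitive G" and gen: "pos_generated G" and genU: "pos_generated U"
    and j: "bij_betw j (ldeg G 1) (ldeg U 1)"
    and j_add: "\<And>u v. u \<in> ldeg G 1 \<Longrightarrow> v \<in> ldeg G 1 \<Longrightarrow> j (ladd G u v) = ladd U (j u) (j v)"
    and j_smul: "\<And>a u. u \<in> ldeg G 1 \<Longrightarrow> j (lsmul G a u) = lsmul U a (j u)"
    and hom_rep: "\<And>k. k \<le> 0 \<Longrightarrow> bij_betw (\<lambda>x. restrict (\<lambda>u. lbr U x u) (ldeg U 1))
                      (ldeg U k) (linmaps U (ldeg U 1) (ldeg U (k + 1)))"
    and \<psi>: "lsa_hom (substr U (part U (\<lambda>k. 1 \<le> k))) G \<psi>"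
    and \<psi>_j: "\<And>u. u \<in> ldeg G 1 \<Longrightarrow> \<psi> (j u) = u"
begin

lemma U1_eq: "ldeg U 1 = j ` ldeg G 1"
  using j by (simp add: bij_betw_def)

lemma j_deg: "u \<in> ldeg G 1 \<Longrightarrow> j u \<in> ldeg U 1"
  by (simp add: U1_eq)

text \<open>Injectivity of \<open>hom_rep\<close>: the test by which equalities in nonpositive
  degrees of U are proved.\<close>

lemma rep_inj:
  assumes "k \<le> 0" "x \<in> ldeg U k" "y \<in> ldeg U k"
    and "\<And>u. u \<in> ldeg G 1 \<Longrightarrow> lbr U x (j u) = lbr U y (j u)"
  shows "x = y"
proof -
  have "inj_on (\<lambda>x. restrict (\<lambda>u. lbr U x u) (ldeg U 1)) (ldeg U k)"
    using hom_rep[OF assms(1)] by (rule bij_betw_imp_inj_on)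
  then show ?thesis
    by (rule inj_onD) (use assms in \<open>auto simp: U1_eq intro!: restrict_ext\<close>)
qed

lemma rep_ex:
  assumes "k \<le> 0" and deg: "\<And>u. u \<in> ldeg G 1 \<Longrightarrow> g u \<in> ldeg U (k + 1)"
    and add: "\<And>u v. u \<in> ldeg G 1 \<Longrightarrow> v \<in> ldeg G 1 \<Longrightarrow> g (ladd G u v) = ladd U (g u) (g v)"
    and smul: "\<And>a u. u \<in> ldeg G 1 \<Longrightarrow> g (lsmul G a u) = lsmul U a (g u)"
  shows "\<exists>x\<in>ldeg U k. \<forall>u\<in>ldeg G 1. lbr U x (j u) = g u"
proof -
  \<comment> \<open>\<open>g\<close> is moved from G_1 to U_1 along \<open>j\<close> and made
    extensional, as membership in \<open>linmaps\<close> demands.\<close>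
  define h where "h = restrict (\<lambda>u. g (inv_into (ldeg G 1) j u)) (ldeg U 1)"
  have hj: "h (j u) = g u" if "u \<in> ldeg G 1" for u
    using that bij_betw_inv_into_left[OF j that] by (simp add: h_def j_deg)
  have "h \<in> linmaps U (ldeg U 1) (ldeg U (k + 1))"
    unfolding linmaps_def
  proof (intro CollectI conjI ballI allI)
    show "h \<in> extensional (ldeg U 1)" by (simp add: h_def)
    show "h v \<in> ldeg U (k + 1)" if "v \<in> ldeg U 1" for v
      using that deg by (auto simp: U1_eq hj)
    show "h (ladd U u v) = ladd U (h u) (h v)" if "u \<in> ldeg U 1" "v \<in> ldeg U 1" for u v
      using that G.deg_add by (auto simp: U1_eq hj add j_add[symmetric])
    show "h (lsmul U a v) = lsmul U a (h v)" if "v \<in> ldeg U 1" for v a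
      using that G.deg_smul by (auto simp: U1_eq hj smul j_smul[symmetric])
  qed
  then have "h \<in> (\<lambda>x. restrict (\<lambda>u. lbr U x u) (ldeg U 1)) ` ldeg U k"
    using bij_betw_imp_surj_on[OF hom_rep[OF assms(1)]] by blast
  then obtain x where x: "x \<in> ldeg U k" "h = restrict (\<lambda>u. lbr U x u) (ldeg U 1)" by blast
  have "lbr U x (j u) = g u" if "u \<in> ldeg G 1" for u
    using hj[OF that] that by (simp add: x(2) j_deg)
  then show ?thesis using x(1) by blast
qed

text \<open>\<open>phi n\<close> embeds degree \<open>1 - n\<close> of \<open>G\<close> into \<open>U\<close>; transitivity makes \<open>x\<close> determined by
  \<open>u \<mapsto> [x, u]\<close>, which is what the non-positive elements of \<open>U\<close> are.\<close>
primrec phi :: "nat \<Rightarrow> 'g \<Rightarrow> 'u" where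
  "phi 0 x = j x"
| "phi (Suc n) x = (THE z. z \<in> ldeg U (- int n) \<and> (\<forall>u\<in>ldeg G 1. lbr U z (j u) = phi n (lbr G x u)))"

text \<open>The invariant of the recursion: only when stage \<open>n\<close> is linear with values
  in the right degree is \<open>u \<mapsto> phi n (lbr G x u)\<close> an element of the Hom space,
  and only then is the description in the next stage known to be met.\<close>

definition linear_phi :: "nat \<Rightarrow> bool" where
  "linear_phi n \<longleftrightarrow> (\<forall>x\<in>ldeg G (1 - int n). phi n x \<in> ldeg U (1 - int n) \<and>
     (\<forall>y\<in>ldeg G (1 - int n). phi n (ladd G x y) = ladd U (phi n x) (phi n y)) \<and>
     (\<forall>a. phi n (lsmul G a x) = lsmul U a (phi n x)))"

text \<open>Surjectivity of \<open>hom_rep\<close> gives an element with the required brackets and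
  injectivity makes it unique, so the definite description is meaningful.\<close>

lemma phi_Suc:
  assumes "linear_phi n" "x \<in> ldeg G (- int n)"
  shows "phi (Suc n) x \<in> ldeg U (- int n)"
    and "u \<in> ldeg G 1 \<Longrightarrow> lbr U (phi (Suc n) x) (j u) = phi n (lbr G x u)"
proof -
  have br: "lbr G x u \<in> ldeg G (1 - int n)" if "u \<in> ldeg G 1" for u
    using G.br_deg[OF assms(2) that] by (simp add: algebra_simps)
  have xc: "x \<in> lcarrier G" using assms(2) G.deg_carrier by blast
  have "\<exists>z\<in>ldeg U (- int n). \<forall>u\<in>ldeg G 1. lbr U z (j u) = phi n (lbr G x u)"
  proof (rule rep_ex)
    show "phi n (lbr G x u) \<in> ldeg U (- int n + 1)" if "u \<in> ldeg G 1" for u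
      using assms(1) br[OF that] by (simp add: linear_phi_def)
    show "phi n (lbr G x (ladd G u v)) = ladd U (phi n (lbr G x u)) (phi n (lbr G x v))"
      if "u \<in> ldeg G 1" "v \<in> ldeg G 1" for u v
      using assms(1) br[OF that(1)] br[OF that(2)] xc that[THEN G.deg_carrier]
      by (simp add: linear_phi_def G.br_add_right)
    show "phi n (lbr G x (lsmul G a u)) = lsmul U a (phi n (lbr G x u))"
      if "u \<in> ldeg G 1" for u a
      using assms(1) br[OF that(1)] xc G.deg_carrier[OF that]
      by (simp add: linear_phi_def G.br_smul_right)
  qed simp
  then have "\<exists>!z. z \<in> ldeg U (- int n) \<and> (\<forall>u\<in>ldeg G 1. lbr U z (j u) = phi n (lbr G x u))"
    using rep_inj[of "- int n"] by (metis neg_le_0_iff_le of_nat_0_le_iff)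
  from theI'[OF this]
  show "phi (Suc n) x \<in> ldeg U (- int n)"
    and "u \<in> ldeg G 1 \<Longrightarrow> lbr U (phi (Suc n) x) (j u) = phi n (lbr G x u)" by simp_all
qed

lemma linear_phi: "linear_phi n"
proof (induction n)
  case 0
  then show ?case by (simp add: linear_phi_def j_deg j_add j_smul)
next
  case (Suc n)
  note spec = phi_Suc[OF Suc]
  have br: "lbr G x u \<in> ldeg G (1 - int n)" if "x \<in> ldeg G (- int n)" "u \<in> ldeg G 1" for x u
    using G.br_deg[OF that] by (simp add: algebra_simps)
  have lin: "x \<in> ldeg G (1 - int n) \<Longrightarrow> y \<in> ldeg G (1 - int n)
      \<Longrightarrow> phi n (ladd G x y) = ladd U (phi n x) (phi n y)"
    "x \<in> ldeg G (1 - int n) \<Longrightarrow> phi n (lsmul G a x) = lsmul U a (phi n x)" for x y a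
    using Suc by (auto simp: linear_phi_def)
  have "phi (Suc n) (ladd G x y) = ladd U (phi (Suc n) x) (phi (Suc n) y)"
    if xy: "x \<in> ldeg G (- int n)" "y \<in> ldeg G (- int n)" for x y
  proof (rule rep_inj)
    show "phi (Suc n) (ladd G x y) \<in> ldeg U (- int n)" using spec(1) G.deg_add xy by blast
    show "ladd U (phi (Suc n) x) (phi (Suc n) y) \<in> ldeg U (- int n)"
      using spec(1) U.deg_add xy by blast
    fix u assume u: "u \<in> ldeg G 1"
    have c: "x \<in> lcarrier G" "y \<in> lcarrier G" "u \<in> lcarrier G" "j u \<in> lcarrier U"
      "phi (Suc n) x \<in> lcarrier U" "phi (Suc n) y \<in> lcarrier U"
      using xy u j_deg spec(1) G.deg_carrier U.deg_carrier by blast+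
    show "lbr U (phi (Suc n) (ladd G x y)) (j u) = lbr U (ladd U (phi (Suc n) x) (phi (Suc n) y)) (j u)"
      using c spec(2)[OF G.deg_add[OF xy] u] spec(2)[OF xy(1) u] spec(2)[OF xy(2) u]
        lin(1)[OF br[OF xy(1) u] br[OF xy(2) u]]
      by (simp add: G.br_add_left U.br_add_left del: phi.simps)
  qed simp
  moreover have "phi (Suc n) (lsmul G a x) = lsmul U a (phi (Suc n) x)"
    if x: "x \<in> ldeg G (- int n)" for x a
  proof (rule rep_inj)
    show "phi (Suc n) (lsmul G a x) \<in> ldeg U (- int n)" using spec(1) G.deg_smul x by blast
    show "lsmul U a (phi (Suc n) x) \<in> ldeg U (- int n)"
      using spec(1) U.deg_smul x by blast
    fix u assume u: "u \<in> ldeg G 1"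
    have c: "x \<in> lcarrier G" "u \<in> lcarrier G" "j u \<in> lcarrier U" "phi (Suc n) x \<in> lcarrier U"
      using x u j_deg spec(1) G.deg_carrier U.deg_carrier by blast+
    show "lbr U (phi (Suc n) (lsmul G a x)) (j u) = lbr U (lsmul U a (phi (Suc n) x)) (j u)"
      using c spec(2)[OF G.deg_smul[OF x] u] spec(2)[OF x u] lin(2)[OF br[OF x u]]
      by (simp add: G.br_smul_left U.br_smul_left del: phi.simps)
  qed simp
  ultimately show ?case using spec(1) by (simp add: linear_phi_def del: phi.simps)
qed

text \<open>Reindexing by degree. Above degree 1 the truncation in \<open>nat\<close> would return
  \<open>j\<close>, so the lemmas below keep to \<open>k \<le> 1\<close>.\<close>

definition \<phi> :: "int \<Rightarrow> 'g \<Rightarrow> 'u" where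
  "\<phi> k = phi (nat (1 - k))"

lemma \<phi>_1 [simp]: "\<phi> 1 = j"
  by (simp add: \<phi>_def fun_eq_iff)

lemma \<phi>_deg: "k \<le> 1 \<Longrightarrow> x \<in> ldeg G k \<Longrightarrow> \<phi> k x \<in> ldeg U k"
  and \<phi>_add: "k \<le> 1 \<Longrightarrow> x \<in> ldeg G k \<Longrightarrow> y \<in> ldeg G k \<Longrightarrow> \<phi> k (ladd G x y) = ladd U (\<phi> k x) (\<phi> k y)"
  and \<phi>_smul: "k \<le> 1 \<Longrightarrow> x \<in> ldeg G k \<Longrightarrow> \<phi> k (lsmul G a x) = lsmul U a (\<phi> k x)"
  using linear_phi[of "nat (1 - k)"] by (auto simp: linear_phi_def \<phi>_def)

lemma \<phi>_br_j:
  assumes "k \<le> 0" "x \<in> ldeg G k" "u \<in> ldeg G 1"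
  shows "lbr U (\<phi> k x) (j u) = \<phi> (k + 1) (lbr G x u)"
proof -
  have "nat (1 - k) = Suc (nat (- k))" "nat (1 - (k + 1)) = nat (- k)" "- int (nat (- k)) = k"
    using assms(1) by auto
  then show ?thesis
    using phi_Suc(2)[OF linear_phi, of x "nat (- k)" u] assms by (simp add: \<phi>_def del: phi.simps)
qed

lemma \<phi>_zero: "k \<le> 1 \<Longrightarrow> \<phi> k (lzero G) = lzero U"
  using \<phi>_smul[of k "lzero G" 0] \<phi>_deg[of k "lzero G"] U.deg_carrier by simp

text \<open>Induction on the distance to degree 1, where \<open>j\<close> is injective. If
  \<open>\<phi>\<close> kills \<open>x\<close> it kills every \<open>lbr G x u\<close>; these vanish
  by induction, and transitivity of G gives \<open>x = 0\<close>.\<close>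

lemma \<phi>_inj:
  "k \<le> 1 \<Longrightarrow> x \<in> ldeg G k \<Longrightarrow> \<phi> k x = lzero U \<Longrightarrow> x = lzero G"
proof (induction "nat (1 - k)" arbitrary: k x)
  case 0
  then have "k = 1" by simp
  then show ?case
    using 0 \<phi>_zero[of 1] inj_onD[OF bij_betw_imp_inj_on[OF j], of x "lzero G"] by simp
next
  case (Suc n)
  then have k: "k \<le> 0" "n = nat (1 - (k + 1))" by auto
  show ?case
  proof (rule G.central_nonpos_zero[OF trans gen k(1) Suc.prems(2)])
    fix u assume u: "u \<in> ldeg G 1"
    have "\<phi> (k + 1) (lbr G x u) = lzero U"
      using \<phi>_br_j[OF k(1) Suc.prems(2) u] Suc.prems(3) U.deg_carrier[OF j_deg[OF u]] by simp
    then show "lbr G x u = lzero G"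
      using Suc.hyps(1)[OF k(2)] k(1) G.br_deg[OF Suc.prems(2) u] by simp
  qed
qed

text \<open>Induction on the distance of the total degree from 1. A factor of degree 1 is handled by
  the construction of \<open>\<phi>\<close> or by antisymmetry. Otherwise both sides are compared
  through their brackets with U_1: Jacobi rewrites these as brackets whose total degree is one
  higher, where the induction hypothesis applies.\<close>

lemma \<phi>_br:
  "i \<le> 1 \<Longrightarrow> k \<le> 1 \<Longrightarrow> i + k \<le> 1 \<Longrightarrow> x \<in> ldeg G i \<Longrightarrow> y \<in> ldeg G k
    \<Longrightarrow> \<phi> (i + k) (lbr G x y) = lbr U (\<phi> i x) (\<phi> k y)"
proof (induction "nat (1 - (i + k))" arbitrary: i k x y rule: less_induct)
  case less
  note x = less.prems(4) and y = less.prems(5)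
  note \<phi>x = \<phi>_deg[OF less.prems(1) x] and \<phi>y = \<phi>_deg[OF less.prems(2) y]
  consider (right) "k = 1" | (left) "i = 1" | (both) "i \<le> 0" "k \<le> 0"
    using less.prems(1,2) by linarith
  then show ?case
  proof cases
    case right
    then show ?thesis using \<phi>_br_j[of i x y] less.prems by simp
  next
    case left
    then have k: "k \<le> 0" using less.prems by simp
    have "\<phi> (i + k) (lbr G x y) = \<phi> (k + 1) (lsmul G (- ssign i k) (lbr G y x))"
      using G.antisym[OF x y] left by (simp add: add.commute)
    also have "\<dots> = lsmul U (- ssign i k) (\<phi> (k + 1) (lbr G y x))"
      using k G.br_deg[OF y x] left by (intro \<phi>_smul) auto
    also have "\<dots> = lsmul U (- ssign i k) (lbr U (\<phi> k y) (\<phi> i x))"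
      using \<phi>_br_j[OF k y, of x] x left by simp
    also have "\<dots> = lbr U (\<phi> i x) (\<phi> k y)"
      using U.antisym[OF \<phi>x \<phi>y] by simp
    finally show ?thesis .
  next
    case both
    show ?thesis
    proof (rule rep_inj)
      show "i + k \<le> 0" using both by simp
      show "\<phi> (i + k) (lbr G x y) \<in> ldeg U (i + k)"
        using both G.br_deg[OF x y] by (intro \<phi>_deg) auto
      show "lbr U (\<phi> i x) (\<phi> k y) \<in> ldeg U (i + k)"
        using U.br_deg[OF \<phi>x \<phi>y] .
      fix u assume u: "u \<in> ldeg G 1"
      note uc = G.deg_carrier[OF u]
      note juc = U.deg_carrier[OF j_deg[OF u]]
      have d1: "lbr G y u \<in> ldeg G (k + 1)" and d2: "lbr G x u \<in> ldeg G (i + 1)"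
        using G.br_deg[OF y u] G.br_deg[OF x u] by auto
      have e: "i + (k + 1) = i + k + 1" "k + (i + 1) = i + k + 1" by auto
      have e1: "lbr G x (lbr G y u) \<in> ldeg G (i + k + 1)"
        and e2: "lbr G y (lbr G x u) \<in> ldeg G (i + k + 1)"
        using G.br_deg[OF x d1] G.br_deg[OF y d2] unfolding e .
      have IH1: "\<phi> (i + k + 1) (lbr G x (lbr G y u)) = lbr U (\<phi> i x) (\<phi> (k + 1) (lbr G y u))"
        using less.hyps[of i "k + 1" x "lbr G y u"] both x d1 by (simp add: add.assoc)
      have IH2: "\<phi> (i + k + 1) (lbr G y (lbr G x u)) = lbr U (\<phi> k y) (\<phi> (i + 1) (lbr G x u))"
        using less.hyps[of k "i + 1" y "lbr G x u"] both y d2 by (simp add: algebra_simps)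
      have "lbr U (\<phi> (i + k) (lbr G x y)) (j u) = \<phi> (i + k + 1) (lbr G (lbr G x y) u)"
        using both G.br_deg[OF x y] u by (intro \<phi>_br_j) auto
      also have "\<dots> = \<phi> (i + k + 1) (ladd G (lbr G x (lbr G y u))
          (lsmul G (- ssign i k) (lbr G y (lbr G x u))))"
        using G.jacobi[OF x y uc] by simp
      also have "\<dots> = ladd U (\<phi> (i + k + 1) (lbr G x (lbr G y u)))
          (lsmul U (- ssign i k) (\<phi> (i + k + 1) (lbr G y (lbr G x u))))"
        using both e1 e2 by (simp add: \<phi>_add \<phi>_smul G.deg_smul)
      also have "\<dots> = ladd U (lbr U (\<phi> i x) (lbr U (\<phi> k y) (j u)))
          (lsmul U (- ssign i k) (lbr U (\<phi> k y) (lbr U (\<phi> i x) (j u))))"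
        unfolding IH1 IH2 using \<phi>_br_j[OF both(1) x u] \<phi>_br_j[OF both(2) y u] by simp
      also have "\<dots> = lbr U (lbr U (\<phi> i x) (\<phi> k y)) (j u)"
        using U.jacobi[OF \<phi>x \<phi>y juc] by simp
      finally show "lbr U (\<phi> (i + k) (lbr G x y)) (j u) = lbr U (lbr U (\<phi> i x) (\<phi> k y)) (j u)" .
    qed
  qed
qed

subsection \<open>The correspondence between \<open>U\<close> and \<open>G\<close>\<close>

lemma \<psi>_props:
  "w \<in> part U (\<lambda>k. 1 \<le> k) \<Longrightarrow> w' \<in> part U (\<lambda>k. 1 \<le> k) \<Longrightarrow> \<psi> (ladd U w w') = ladd G (\<psi> w) (\<psi> w')"
  "w \<in> part U (\<lambda>k. 1 \<le> k) \<Longrightarrow> \<psi> (lsmul U a w) = lsmul G a (\<psi> w)"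
  "w \<in> part U (\<lambda>k. 1 \<le> k) \<Longrightarrow> w' \<in> part U (\<lambda>k. 1 \<le> k) \<Longrightarrow> \<psi> (lbr U w w') = lbr G (\<psi> w) (\<psi> w')"
  "w \<in> part U (\<lambda>k. 1 \<le> k) \<Longrightarrow> \<psi> w \<in> lcarrier G"
  using \<psi> by (auto simp: lsa_hom_def)

lemma \<psi>_deg: "1 \<le> k \<Longrightarrow> w \<in> ldeg U k \<Longrightarrow> \<psi> w \<in> ldeg G k"
  using \<psi> U.part_deg[of w k "\<lambda>k. 1 \<le> k"] unfolding lsa_hom_def substr_simps by blast

lemma \<psi>_zero: "\<psi> (lzero U) = lzero G"
  using \<psi>_props(2)[of "lzero U" 0] \<psi>_props(4)[of "lzero U"] by simp

text \<open>A relation rather than a map, since \<open>\<phi>\<close> runs from G to U and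
  \<open>\<psi>\<close> from U to G. In degree 1 the two agree because \<open>\<psi>\<close> inverts
  \<open>j\<close>.\<close>

definition rel_deg :: "int \<Rightarrow> 'u \<Rightarrow> 'g \<Rightarrow> bool" where
  "rel_deg k a x \<longleftrightarrow> (if k \<le> 0 then x \<in> ldeg G k \<and> a = \<phi> k x else a \<in> ldeg U k \<and> x = \<psi> a)"

lemma rel_deg_pos: "1 \<le> k \<Longrightarrow> a \<in> ldeg U k \<Longrightarrow> rel_deg k a (\<psi> a)"
  by (simp add: rel_deg_def)

lemma rel_degD1: "rel_deg k a x \<Longrightarrow> a \<in> ldeg U k"
  and rel_degD2: "rel_deg k a x \<Longrightarrow> x \<in> ldeg G k"
  by (auto simp: rel_deg_def \<phi>_deg \<psi>_deg split: if_splits)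

lemma rel_deg_carrier:
  "rel_deg k a x \<Longrightarrow> a \<in> lcarrier U" "rel_deg k a x \<Longrightarrow> x \<in> lcarrier G"
  using rel_degD1 rel_degD2 G.deg_carrier U.deg_carrier by blast+

lemma rel_deg_zero: "rel_deg k (lzero U) (lzero G)"
  by (simp add: rel_deg_def \<phi>_zero \<psi>_zero)

lemma rel_deg_add:
  assumes "rel_deg k a x" "rel_deg k b y"
  shows "rel_deg k (ladd U a b) (ladd G x y)"
  using assms U.part_deg[of _ k "\<lambda>k. 1 \<le> k"]
  by (auto simp: rel_deg_def \<phi>_add \<psi>_props G.deg_add U.deg_add split: if_splits)

lemma rel_deg_smul:
  assumes "rel_deg k a x"
  shows "rel_deg k (lsmul U c a) (lsmul G c x)"
  using assms U.part_deg[of _ k "\<lambda>k. 1 \<le> k"]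
  by (auto simp: rel_deg_def \<phi>_smul \<psi>_props G.deg_smul U.deg_smul split: if_splits)

lemma rel_deg_\<phi>: "k \<le> 1 \<Longrightarrow> x \<in> ldeg G k \<Longrightarrow> rel_deg k (\<phi> k x) x"
  by (cases "k = 1") (auto simp: rel_deg_def j_deg \<psi>_j)

text \<open>In nonpositive degrees this is injectivity of \<open>\<phi>\<close>, hence ultimately
  transitivity of G; in positive degrees \<open>\<psi>\<close> is a function.\<close>

lemma rel_deg_single_valued: "rel_deg k (lzero U) x \<Longrightarrow> x = lzero G"
  using \<phi>_inj[of k x] by (auto simp: rel_deg_def \<psi>_zero split: if_splits)

text \<open>The bound 1 is what places the ideal in degrees at least 2: \<open>\<psi>\<close> is
  injective on U_1, but possibly not higher up.\<close>

lemma rel_deg_kernel: "k \<le> 1 \<Longrightarrow> rel_deg k a (lzero G) \<Longrightarrow> a = lzero U"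
  using \<phi>_zero[of 1] by (cases "k = 1") (auto simp: rel_deg_def \<phi>_zero U1_eq \<psi>_j split: if_splits)

lemma rel_deg_br_swap:
  assumes "rel_deg i a x" "rel_deg k b y" "rel_deg (i + k) (lbr U a b) (lbr G x y)"
  shows "rel_deg (k + i) (lbr U b a) (lbr G y x)"
  using rel_deg_smul[OF assms(3), of "- ssign k i"]
    U.antisym[OF rel_degD1[OF assms(2)] rel_degD1[OF assms(1)]]
    G.antisym[OF rel_degD2[OF assms(2)] rel_degD2[OF assms(1)]]
  by (simp add: add.commute)

lemma rel_deg_br_pos:
  assumes "1 \<le> i" "1 \<le> k" "rel_deg i a x" "rel_deg k b y"
  shows "rel_deg (i + k) (lbr U a b) (lbr G x y)"
  using assms U.part_deg[of a i "\<lambda>k. 1 \<le> k"] U.part_deg[of b k "\<lambda>k. 1 \<le> k"] U.br_deg[of a i b k]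
  by (auto simp: rel_deg_def \<psi>_props)

text \<open>Induction on how \<open>w\<close> is generated. On generators this is the defining
  property of \<open>\<phi>\<close>; for a bracket, \<open>a\<close> and \<open>x\<close> act as
  superderivations with equal signs on the two sides, so the relation carries over term by
  term.\<close>

lemma rel_deg_br_mixed:
  "hspan U k w \<Longrightarrow> i \<le> 0 \<Longrightarrow> rel_deg i a x \<Longrightarrow> rel_deg (i + k) (lbr U a w) (lbr G x (\<psi> w))"
proof (induction arbitrary: i a x rule: hspan.induct)
  case (gen w)
  then obtain u where u: "u \<in> ldeg G 1" "w = j u" by (auto simp: U1_eq)
  have x: "x \<in> ldeg G i" "a = \<phi> i x" using gen by (auto simp: rel_deg_def)
  show ?case
    using rel_deg_\<phi>[of "i + 1" "lbr G x u"] \<phi>_br_j[OF gen(2) x(1) u(1)] G.br_deg[OF x(1) u(1)] gen(2)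
    by (simp add: u x \<psi>_j)
next
  case (zero k)
  then show ?case by (simp add: rel_deg_carrier \<psi>_zero rel_deg_zero)
next
  case (add k w w')
  have p: "w \<in> part U (\<lambda>k. 1 \<le> k)" "w' \<in> part U (\<lambda>k. 1 \<le> k)"
    using add.hyps U.hspan_lie_span U.lie_span_subset_part by blast+
  show ?case
    using rel_deg_add[OF add.IH(1)[OF add.prems] add.IH(2)[OF add.prems]] rel_deg_carrier[OF add.prems(2)]
      U.part_carrier[OF p(1)] U.part_carrier[OF p(2)]
    by (simp add: \<psi>_props p U.br_add_right G.br_add_right)
next
  case (smul k w c)
  have p: "w \<in> part U (\<lambda>k. 1 \<le> k)"
    using smul.hyps U.hspan_lie_span U.lie_span_subset_part by blast
  show ?case
    using rel_deg_smul[OF smul.IH[OF smul.prems]] rel_deg_carrier[OF smul.prems(2)]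
      U.part_carrier[OF p(1)]
    by (simp add: \<psi>_props p U.br_smul_right G.br_smul_right)
next
  case (br k1 w1 k2 w2)
  have p: "w1 \<in> part U (\<lambda>k. 1 \<le> k)" "w2 \<in> part U (\<lambda>k. 1 \<le> k)"
    using br.hyps U.hspan_lie_span U.lie_span_subset_part by blast+
  note c = rel_deg_carrier[OF br.prems(2)] U.part_carrier[OF p(1)] U.part_carrier[OF p(2)]
    \<psi>_props(4)[OF p(1)] \<psi>_props(4)[OF p(2)]
  show ?case
  proof (cases "1 \<le> k1 \<and> 1 \<le> k2")
    case False
    then have "w1 = lzero U \<or> w2 = lzero U" using br.hyps U.hspan_nonpos by force
    then have "lbr U w1 w2 = lzero U" using c by auto
    then show ?thesis using c by (simp add: \<psi>_zero rel_deg_zero)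
  next
    case True
    have w1: "rel_deg k1 w1 (\<psi> w1)" and w2: "rel_deg k2 w2 (\<psi> w2)"
      using True br.hyps U.hspan_deg by (auto intro: rel_deg_pos)
    \<comment> \<open>The intermediate brackets may already have positive degree. The induction
      hypothesis covers \<open>m \<le> 0\<close>, and multiplicativity of \<open>\<psi>\<close>
      covers the rest.\<close>
    have step1: "rel_deg (m + k1) (lbr U b w1) (lbr G y (\<psi> w1))" if "rel_deg m b y" for m b y
      using that br.IH(1)[of m b y] rel_deg_br_pos[of m k1 b y w1] True w1 by (cases "m \<le> 0") auto
    have step2: "rel_deg (m + k2) (lbr U b w2) (lbr G y (\<psi> w2))" if "rel_deg m b y" for m b y
      using that br.IH(2)[of m b y] rel_deg_br_pos[of m k2 b y w2] True w2 by (cases "m \<le> 0") auto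
    have 1: "rel_deg (i + k1 + k2) (lbr U (lbr U a w1) w2) (lbr G (lbr G x (\<psi> w1)) (\<psi> w2))"
      using step2[OF step1[OF br.prems(2)]] .
    have 2: "rel_deg (k1 + (i + k2)) (lbr U w1 (lbr U a w2)) (lbr G (\<psi> w1) (lbr G x (\<psi> w2)))"
      using rel_deg_br_swap[OF step2[OF br.prems(2)] w1 step1[OF step2[OF br.prems(2)]]] .
    have "rel_deg (i + (k1 + k2))
        (ladd U (lbr U (lbr U a w1) w2) (lsmul U (ssign i k1) (lbr U w1 (lbr U a w2))))
        (ladd G (lbr G (lbr G x (\<psi> w1)) (\<psi> w2)) (lsmul G (ssign i k1) (lbr G (\<psi> w1) (lbr G x (\<psi> w2)))))"
      using 1 2 by (intro rel_deg_add rel_deg_smul) (simp_all add: algebra_simps)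
    then show ?thesis
      using U.br_derivation[OF rel_degD1[OF br.prems(2)] rel_degD1[OF w1] c(4)]
        G.br_derivation[OF rel_degD2[OF br.prems(2)] rel_degD2[OF w1] c(6)]
      by (simp add: \<psi>_props p)
  qed
qed

lemma rel_deg_br:
  assumes "rel_deg i a x" "rel_deg k b y"
  shows "rel_deg (i + k) (lbr U a b) (lbr G x y)"
proof -
  have mixed: "rel_deg (i + k) (lbr U a b) (lbr G x y)"
    if "i \<le> 0" "1 \<le> k" "rel_deg i a x" "rel_deg k b y" for i a x k b y
    using rel_deg_br_mixed[OF U.pos_generated_hspan[OF genU that(2) rel_degD1[OF that(4)]] that(1,3)]
      that(2,4) by (simp add: rel_deg_def)
  consider "i \<le> 0" "k \<le> 0" | "i \<le> 0" "1 \<le> k" | "1 \<le> i" "k \<le> 0" | "1 \<le> i" "1 \<le> k" by linarith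
  then show ?thesis
  proof cases
    case 1
    then show ?thesis
      using assms \<phi>_br[of i k x y] G.br_deg[of x i y k] by (simp add: rel_deg_def)
  next
    case 2
    then show ?thesis using mixed assms by blast
  next
    case 3
    then show ?thesis using rel_deg_br_swap[OF assms(2,1) mixed[OF 3(2,1) assms(2,1)]] by simp
  next
    case 4
    then show ?thesis using rel_deg_br_pos assms by blast
  qed
qed

text \<open>In positive degrees this uses that G_+ is generated by G_1: the elements with a partner
  include G_1 and are closed under the operations.\<close>

lemma rel_deg_total:
  assumes "x \<in> ldeg G k" shows "\<exists>a. rel_deg k a x"
proof (cases "k \<le> 0")
  case True
  then show ?thesis using rel_deg_\<phi>[of k x] assms by auto
next
  case False
  then have "hspan G k x" using G.pos_generated_hspan[OF gen _ assms] by simp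
  then show ?thesis
  proof induction
    case (gen x)
    then show ?case using rel_deg_\<phi>[of 1 x] by auto
  next
    case (zero k)
    then show ?case using rel_deg_zero by blast
  next
    case (add k x y)
    then show ?case using rel_deg_add by blast
  next
    case (smul k x a)
    then show ?case using rel_deg_smul by blast
  next
    case (br i x j y)
    then show ?case using rel_deg_br by blast
  qed
qed

section \<open>The relation on inhomogeneous elements\<close>

definition rel :: "'u \<Rightarrow> 'g \<Rightarrow> bool" where
  "rel a x \<longleftrightarrow> a \<in> lcarrier U \<and> x \<in> lcarrier G \<and> (\<forall>k. rel_deg k (comp U k a) (comp G k x))"

lemma rel_carrier: "rel a x \<Longrightarrow> a \<in> lcarrier U" "rel a x \<Longrightarrow> x \<in> lcarrier G"
  by (auto simp: rel_def)

lemma rel_zero: "rel (lzero U) (lzero G)"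
  by (simp add: rel_def rel_deg_zero)

lemma rel_add: "rel a x \<Longrightarrow> rel b y \<Longrightarrow> rel (ladd U a b) (ladd G x y)"
  by (simp add: rel_def rel_deg_add)

lemma rel_smul: "rel a x \<Longrightarrow> rel (lsmul U c a) (lsmul G c x)"
  by (simp add: rel_def rel_deg_smul)

lemma rel_of_rel_deg:
  assumes "rel_deg k a x" shows "rel a x"
  using U.comp_homogeneous[OF rel_degD1[OF assms]] G.comp_homogeneous[OF rel_degD2[OF assms]]
    rel_deg_carrier[OF assms] assms
  by (simp add: rel_def rel_deg_zero)

lemma rel_comp: "rel a x \<Longrightarrow> rel (comp U k a) (comp G k x)"
  by (simp add: rel_def rel_deg_zero)

lemma rel_br:
  assumes "rel a x" "rel b y" shows "rel (lbr U a b) (lbr G x y)"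
proof -
  note c = rel_carrier[OF assms(1)] rel_carrier[OF assms(2)]
  note gvs = U.graded_vs_axioms G.graded_vs_axioms
  have hom: "rel (lbr U (comp U i a) (comp U k b)) (lbr G (comp G i x) (comp G k y))" for i k
    by (rule rel_of_rel_deg[OF rel_deg_br]) (use assms in \<open>auto simp: rel_def\<close>)
  have "rel (lbr U (comp U i a) b) (lbr G (comp G i x) y)" for i
    by (rule graded_pair_induct[where
          Q = "\<lambda>v w. rel (lbr U (comp U i a) v) (lbr G (comp G i x) w)", OF gvs c(3,4)])
      (use c hom in \<open>auto simp: rel_zero U.br_add_right G.br_add_right intro: rel_add\<close>)
  then show ?thesis
    by (intro graded_pair_induct[where Q = "\<lambda>v w. rel (lbr U v b) (lbr G w y)", OF gvs c(1,2)])
      (use c in \<open>auto simp: rel_zero U.br_add_left G.br_add_left intro: rel_add\<close>)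
qed

lemma rel_single_valued:
  assumes "rel (lzero U) x" shows "x = lzero G"
  by (rule G.eq_by_comp) (use assms rel_deg_single_valued in \<open>auto simp: rel_def\<close>)

lemma rel_total:
  assumes x: "x \<in> lcarrier G" shows "\<exists>a. rel a x"
proof -
  obtain n where n: "\<And>k. k < - int n \<or> int n < k \<Longrightarrow> comp G k x = lzero G"
    using G.comp_bound[OF x] by blast
  \<comment> \<open>A zero component gets the partner zero, so that the chosen partners have finite
    support and sum to an element of U.\<close>
  have "\<exists>a. rel_deg k a (comp G k x) \<and> (comp G k x = lzero G \<longrightarrow> a = lzero U)" for k
    using rel_deg_total[OF G.comp_deg[OF x], of k] rel_deg_zero[of k]
    by (cases "comp G k x = lzero G") auto
  then obtain c where c: "\<And>k. rel_deg k (c k) (comp G k x)" "\<And>k. comp G k x = lzero G \<Longrightarrow> c k = lzero U"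
    by metis
  have "\<exists>a\<in>lcarrier U. \<forall>k. comp U k a = c k"
    by (rule U.ex_with_comps[of _ n]) (rule rel_degD1[OF c(1)], use c(2) n in blast)
  then show ?thesis using c(1) x by (auto simp: rel_def)
qed

lemma rel_dom:
  assumes a: "a \<in> lcarrier U" and k: "\<And>k. \<exists>x. rel_deg k (comp U k a) x"
  shows "\<exists>x. rel a x"
proof -
  obtain n where n: "\<And>k. k < - int n \<or> int n < k \<Longrightarrow> comp U k a = lzero U"
    using U.comp_bound[OF a] by blast
  obtain c where c: "\<And>k. rel_deg k (comp U k a) (c k)" using k by metis
  have "\<exists>x\<in>lcarrier G. \<forall>k. comp G k x = c k"
  proof (rule G.ex_with_comps[of _ n])
    \<comment> \<open>Finite support comes for free here: zero is related to zero alone.\<close>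
    show "c k = lzero G" if "k < - int n \<or> int n < k" for k
      using c[of k] n[OF that] rel_deg_single_valued by simp
  qed (use c rel_degD2 in auto)
  then show ?thesis using c a by (auto simp: rel_def)
qed

section \<open>The subalgebra, the ideal and the isomorphism\<close>

definition S where "S = {a. \<exists>x. rel a x}"
definition D where "D = {a. rel a (lzero G)}"
definition T where "T = S \<inter> part U (\<lambda>k. k \<le> 0)"

lemma S_carrier: "a \<in> S \<Longrightarrow> a \<in> lcarrier U"
  using rel_carrier by (auto simp: S_def)

lemma pos_subset_S: "part U (\<lambda>k. 1 \<le> k) \<subseteq> S"
proof
  fix a assume a: "a \<in> part U (\<lambda>k. 1 \<le> k)"
  then have ac: "a \<in> lcarrier U" by (rule U.part_carrier)
  have "\<exists>x. rel_deg k (comp U k a) x" for k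
    using a ac rel_deg_pos[of k "comp U k a"] rel_deg_zero[of k] by (cases "1 \<le> k") (auto simp: part_def)
  then show "a \<in> S" using rel_dom[OF ac] by (simp add: S_def)
qed

lemma subalgebra_S: "subalgebra U S"
  unfolding subalgebra_def graded_subspace_def subspace_def
proof (intro conjI ballI allI subsetI)
  show "lzero U \<in> S" using rel_zero unfolding S_def by blast
  show "a \<in> lcarrier U" if "a \<in> S" for a using that by (rule S_carrier)
  show "ladd U a b \<in> S" if "a \<in> S" "b \<in> S" for a b using that rel_add unfolding S_def by blast
  show "lsmul U c a \<in> S" if "a \<in> S" for a c using that rel_smul unfolding S_def by blast
  show "comp U k a \<in> S" if "a \<in> S" for a k using that rel_comp unfolding S_def by blast
  show "lbr U a b \<in> S" if "a \<in> S" "b \<in> S" for a b using that rel_br unfolding S_def by blast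
qed

lemma subspace_T: "Defs.subspace U T"
  using subalgebra_S U.graded_subspace_part
  unfolding subalgebra_def graded_subspace_def subspace_def T_def by blast

lemma dsum_T: "dsum U T (part U (\<lambda>k. 1 \<le> k)) = S"
proof (intro equalityI subsetI)
  fix a assume "a \<in> dsum U T (part U (\<lambda>k. 1 \<le> k))"
  then show "a \<in> S"
    using subalgebra_S pos_subset_S
    unfolding dsum_def T_def subalgebra_def graded_subspace_def subspace_def by blast
next
  fix a assume a: "a \<in> S"
  then have ac: "a \<in> lcarrier U" by (rule S_carrier)
  obtain t where t: "t \<in> lcarrier U" "\<And>k. comp U k t = (if k \<le> 0 then comp U k a else lzero U)"
    using U.restrict_comps[OF ac, of "\<lambda>k. k \<le> 0"] by blast
  obtain w where w: "w \<in> lcarrier U" "\<And>k. comp U k w = (if 1 \<le> k then comp U k a else lzero U)"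
    using U.restrict_comps[OF ac, of "\<lambda>k. 1 \<le> k"] by blast
  obtain x where x: "rel a x" using a by (auto simp: S_def)
  \<comment> \<open>Truncation stays in the domain, as a component replaced by zero is related to
    zero.\<close>
  have "\<exists>y. rel_deg k (comp U k t) y" for k
    using x rel_deg_zero[of k] by (cases "k \<le> 0") (auto simp: t(2) rel_def)
  then have "t \<in> T" using rel_dom[OF t(1)] t by (auto simp: T_def S_def part_def)
  moreover have "w \<in> part U (\<lambda>k. 1 \<le> k)" using w by (auto simp: part_def)
  moreover have "a = ladd U t w"
    by (rule U.eq_by_comp) (use ac t w in auto)
  ultimately show "a \<in> dsum U T (part U (\<lambda>k. 1 \<le> k))" by (auto simp: dsum_def)
qed

text \<open>If \<open>s\<close> is related to some \<open>x\<close> and \<open>d\<close> to zero,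
  then their bracket is related to the bracket of \<open>x\<close> with zero, which is zero.\<close>

lemma ideal_D: "ideal U S D"
  unfolding ideal_def graded_subspace_def subspace_def
proof (intro conjI ballI allI subsetI)
  show "lbr U s d \<in> D" if s: "s \<in> S" and d: "d \<in> D" for s d
  proof -
    obtain x where "rel s x" using s by (auto simp: S_def)
    then show ?thesis using rel_br[of s x d "lzero G"] d rel_carrier by (simp add: D_def)
  qed
  show "ladd U x y \<in> D" if "x \<in> D" "y \<in> D" for x y
    using rel_add[of x "lzero G" y "lzero G"] that by (simp add: D_def)
  show "lsmul U a x \<in> D" if "x \<in> D" for x a
    using rel_smul[of x "lzero G" a] that by (simp add: D_def)
  show "comp U k x \<in> D" if "x \<in> D" for x k
    using rel_comp[of x "lzero G" k] that by (simp add: D_def)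
qed (auto simp: D_def S_def rel_zero rel_carrier)

lemma D_subset: "D \<subseteq> part U (\<lambda>k. 2 \<le> k)"
proof
  fix d assume d: "d \<in> D"
  have "comp U k d = lzero U" if "\<not> 2 \<le> k" for k
    by (rule rel_deg_kernel[of k]) (use d that in \<open>auto simp: D_def rel_def dest: spec[of _ k]\<close>)
  then show "d \<in> part U (\<lambda>k. 2 \<le> k)" using d rel_carrier by (auto simp: part_def D_def)
qed

text \<open>Each element of G goes to the coset of any of its partners: two partners differ by an
  element related to zero, hence by an element of \<open>D\<close>.\<close>

lemma iso_quot: "\<exists>f. lsa_iso G (quot U S D) f"
proof -
  interpret Q: lsa_quot U S D
    by (rule lsa_quot.intro[OF U.lsalg_axioms]) (simp add: lsa_quot_axioms_def subalgebra_S ideal_D)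
  define f where "f x = coset U D (SOME a. rel a x)" for x
  have f: "f x = coset U D a" if "rel a x" for a x
  proof -
    have b: "rel (SOME a. rel a x) x" using that by (rule someI)
    have "rel (ladd U (SOME a. rel a x) (lsmul U (- 1) a)) (ladd G x (lsmul G (- 1) x))"
      using rel_add[OF b rel_smul[OF that]] .
    then have "ladd U (SOME a. rel a x) (lsmul U (- 1) a) \<in> D"
      using G.add_minus rel_carrier[OF that] by (simp add: D_def)
    then show ?thesis
      unfolding f_def using Q.coset_eqI rel_carrier(1)[OF b] rel_carrier(1)[OF that] by blast
  qed
  have S: "a \<in> S" if "rel a x" for a x using that by (auto simp: S_def)
  have "lsa_hom G (quot U S D) f"
    unfolding lsa_hom_def
  proof (intro conjI ballI allI subsetI)
    show "f x \<in> lcarrier (quot U S D)" if "x \<in> lcarrier G" for x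
      using rel_total[OF that] f S by auto
    fix x assume x: "x \<in> lcarrier G"
    obtain a where a: "rel a x" using rel_total[OF x] by blast
    show "f (lsmul G c x) = lsmul (quot U S D) c (f x)" for c
      using f[OF a] f[OF rel_smul[OF a]] Q.quot_smul[OF S[OF a]] by simp
    fix y assume y: "y \<in> lcarrier G"
    obtain b where b: "rel b y" using rel_total[OF y] by blast
    show "f (ladd G x y) = ladd (quot U S D) (f x) (f y)"
      using f[OF a] f[OF b] f[OF rel_add[OF a b]] Q.quot_add[OF S[OF a] S[OF b]] by simp
    show "f (lbr G x y) = lbr (quot U S D) (f x) (f y)"
      using f[OF a] f[OF b] f[OF rel_br[OF a b]] Q.quot_br[OF S[OF a] S[OF b]] by simp
  next
    fix k z assume "z \<in> f ` ldeg G k"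
    then obtain x where x: "x \<in> ldeg G k" "z = f x" by blast
    obtain a where a: "rel_deg k a x" using rel_deg_total[OF x(1)] by blast
    show "z \<in> ldeg (quot U S D) k"
      using x f[OF rel_of_rel_deg[OF a]] S[OF rel_of_rel_deg[OF a]] rel_degD1[OF a] by auto
  qed
  moreover have "inj_on f (lcarrier G)"
  proof (rule inj_onI)
    fix x y assume x: "x \<in> lcarrier G" and y: "y \<in> lcarrier G" and eq: "f x = f y"
    obtain a where a: "rel a x" using rel_total[OF x] by blast
    obtain b where b: "rel b y" using rel_total[OF y] by blast
    define d where "d = ladd U a (lsmul U (- 1) b)"
    have dc: "d \<in> lcarrier U" using rel_carrier a b by (simp add: d_def)
    have "rel d (ladd G x (lsmul G (- 1) y))"
      unfolding d_def using rel_add[OF a rel_smul[OF b]] .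
    moreover have "rel d (lzero G)"
      using Q.coset_eqD[of a b] eq f[OF a] f[OF b] rel_carrier a b by (simp add: D_def d_def)
    \<comment> \<open>\<open>d\<close> is related both to the difference of \<open>x\<close> and
      \<open>y\<close> and to zero. Subtracting relates zero to that difference, which vanishes by
      single-valuedness.\<close>
    ultimately have "rel (ladd U d (lsmul U (- 1) d))
        (ladd G (ladd G x (lsmul G (- 1) y)) (lsmul G (- 1) (lzero G)))"
      using rel_add rel_smul by blast
    then have "ladd G x (lsmul G (- 1) y) = lzero G"
      using rel_single_valued U.add_minus[OF dc] x y by simp
    then show "x = y" using G.diff_eq_zero x y by blast
  qed
  moreover have "f ` lcarrier G = lcarrier (quot U S D)"
  proof (intro equalityI subsetI)
    fix z assume "z \<in> f ` lcarrier G"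
    then show "z \<in> lcarrier (quot U S D)" using rel_total f S by force
  next
    fix z assume "z \<in> lcarrier (quot U S D)"
    then obtain a x where "rel a x" "z = coset U D a" by (auto simp: S_def)
    then show "z \<in> f ` lcarrier G" using f rel_carrier by blast
  qed
  ultimately show ?thesis by (auto simp: lsa_iso_def bij_betw_def)
qed

end

section \<open>Infinite ground field and conclusion\<close>

lemma infinite_K:
  assumes "K_is_R_or_C TYPE('k::field)"
  shows "infinite (UNIV :: 'k set)"
proof
  assume fin: "finite (UNIV :: 'k set)"
  show False
    using assms unfolding K_is_R_or_C_def
  proof (elim disjE exE conjE)
    fix f :: "'k \<Rightarrow> real" assume "bij f"
    then have "finite (UNIV :: real set)" using fin by (metis bij_is_surj finite_imageI)
    then show False by (simp add: infinite_UNIV_char_0)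
  next
    fix f :: "'k \<Rightarrow> complex" assume "bij f"
    then have "finite (UNIV :: complex set)" using fin by (metis bij_is_surj finite_imageI)
    then show False by (simp add: infinite_UNIV_char_0)
  qed
qed

theorem theorem3p5:
  fixes G :: "('k::field, 'g) lsa" and U :: "('k, 'u) lsa" and j :: "'g \<Rightarrow> 'u"
  assumes "K_is_R_or_C TYPE('k)"
    and "lie_superalgebra G" and "pos_0_transitive G" and "pos_generated G"
    and "universal_lsa G U j"
  shows "(\<exists>T D. T \<subseteq> part U (\<lambda>k. k \<le> 0) \<and> subspace U T
            \<and> subalgebra U (dsum U T (part U (\<lambda>k. 1 \<le> k)))
            \<and> ideal U (dsum U T (part U (\<lambda>k. 1 \<le> k))) D
            \<and> D \<subseteq> part U (\<lambda>k. 2 \<le> k)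
            \<and> (\<exists>f. lsa_iso G (quot U (dsum U T (part U (\<lambda>k. 1 \<le> k))) D) f))
       \<and> (\<forall>T D. T \<subseteq> part U (\<lambda>k. k \<le> 0) \<and> subspace U T
            \<and> subalgebra U (dsum U T (part U (\<lambda>k. 1 \<le> k)))
            \<and> ideal U (dsum U T (part U (\<lambda>k. 1 \<le> k))) D
            \<and> D \<subseteq> part U (\<lambda>k. 2 \<le> k)
            \<longrightarrow> lie_superalgebra (quot U (dsum U T (part U (\<lambda>k. 1 \<le> k))) D)
              \<and> pos_0_transitive (quot U (dsum U T (part U (\<lambda>k. 1 \<le> k))) D)
              \<and> pos_generated (quot U (dsum U T (part U (\<lambda>k. 1 \<le> k))) D))"
proof -
  have lieU: "lie_superalgebra U" and free: "free_pos U"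
    and j: "bij_betw j (ldeg G 1) (ldeg U 1)"
    and j_add: "\<And>u v. u \<in> ldeg G 1 \<Longrightarrow> v \<in> ldeg G 1 \<Longrightarrow> j (ladd G u v) = ladd U (j u) (j v)"
    and j_smul: "\<And>a u. u \<in> ldeg G 1 \<Longrightarrow> j (lsmul G a u) = lsmul U a (j u)"
    and hom_rep: "\<And>k. k \<le> 0 \<Longrightarrow> bij_betw (\<lambda>x. restrict (\<lambda>u. lbr U x u) (ldeg U 1))
                      (ldeg U k) (linmaps U (ldeg U 1) (ldeg U (k + 1)))"
    using assms(5) unfolding universal_lsa_def by blast+
  interpret G: lsalg G by (rule lsalgI[OF assms(2)])
  interpret U: lsalg U by (rule lsalgI[OF lieU])
  note genU = U.free_pos_generated[OF free]
  obtain \<psi> where \<psi>: "lsa_hom (substr U (part U (\<lambda>k. 1 \<le> k))) G \<psi>" "\<forall>u\<in>ldeg G 1. \<psi> (j u) = u"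
    using free_pos_lift[OF infinite_K[OF assms(1)] G.lsalg_axioms U.lsalg_axioms assms(4) free j
        j_add j_smul] by blast
  interpret R: universal_rel G U j \<psi>
    by (intro universal_rel.intro universal_rel_axioms.intro G.lsalg_axioms U.lsalg_axioms assms(3,4)
        genU j j_add j_smul hom_rep \<psi>(1) \<psi>(2)[rule_format])
  have a: "R.T \<subseteq> part U (\<lambda>k. k \<le> 0) \<and> subspace U R.T
      \<and> subalgebra U (dsum U R.T (part U (\<lambda>k. 1 \<le> k)))
      \<and> ideal U (dsum U R.T (part U (\<lambda>k. 1 \<le> k))) R.D
      \<and> R.D \<subseteq> part U (\<lambda>k. 2 \<le> k)
      \<and> (\<exists>f. lsa_iso G (quot U (dsum U R.T (part U (\<lambda>k. 1 \<le> k))) R.D) f)"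
    unfolding R.dsum_T
    using R.subspace_T R.subalgebra_S R.ideal_D R.D_subset R.iso_quot by (simp add: R.T_def)
  have b: "lie_superalgebra (quot U S D) \<and> pos_0_transitive (quot U S D) \<and> pos_generated (quot U S D)"
    if S: "S = dsum U T (part U (\<lambda>k. 1 \<le> k))" and T: "subspace U T" and sub: "subalgebra U S"
      and ideal: "ideal U S D" and D: "D \<subseteq> part U (\<lambda>k. 2 \<le> k)" for S T D
  proof -
    interpret Q: lsa_quot U S D
      by (rule lsa_quot.intro[OF U.lsalg_axioms]) (simp add: lsa_quot_axioms_def sub ideal)
    \<comment> \<open>The subspace \<open>T\<close> contains zero, so U_+ itself lies in the
      sum.\<close>
    have pos: "part U (\<lambda>k. 1 \<le> k) \<subseteq> S"
    proof
      fix w assume w: "w \<in> part U (\<lambda>k. 1 \<le> k)"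
      then have "w = ladd U (lzero U) w" using U.part_carrier by simp
      then show "w \<in> S" using w T unfolding S dsum_def subspace_def by blast
    qed
    \<comment> \<open>Comparison with zero in \<open>rep_inj\<close>: an element of nonpositive
      degree of U is the linear map it induces on U_1.\<close>
    have inj: "x = lzero U"
      if "k \<le> 0" "x \<in> ldeg U k" "\<And>u. u \<in> ldeg U 1 \<Longrightarrow> lbr U x u = lzero U" for k x
      by (rule R.rep_inj[OF that(1,2)]) (simp_all add: that(3) R.j_deg U.deg_carrier[OF R.j_deg])
    have "pos_0_transitive (quot U S D)"
      by (rule Q.pos_0_transitive_quot[OF _ pos D]) (rule inj)
    then show ?thesis
      using Q.lie_superalgebra_quot Q.pos_generated_quot[OF genU pos D] by simp
  qed
  show ?thesis
    by (intro conjI exI[of _ R.T] exI[of _ R.D] allI impI a[THEN conjunct1] a[THEN conjunct2])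
      (use b[OF refl] in simp_all)
qed

end
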